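(* Let $q\in(1/2,1)$, and let $\alpha=x_1^2/r^2$, $\beta=x_1x_3/r^2$ (smooth functions on $S^2$), and $Y=x_3\partial_1-x_1\partial_3$. Let $(\overline g,\overline\pi)$ be a vacuum asymptotically flat initial data set which, for some constants $A,B_1,B_2,B_3$, satisfies in its asymptotically flat chart $$\overline g_{ij}=\left(1+\frac Ar\right)\delta_{ij}+\frac{\alpha}{r}\left(\frac{x_ix_j}{r^2}-\frac12\delta_{ij}\right)+O_2(r^{-1-q}),$$ $$\overline\pi_{ij}=\frac{\beta}{r^2}\frac{x_ix_j}{r^2}+\frac1{r^3}\Big[-B_ix_j-B_jx_i+\sum_l(B_lx_l)\delta_{ij}\Big]+O_1(r^{-2-q}).$$ Then (because of $\beta$) $(\overline g,\overline\pi)$ violates the Regge–Teitelboim condition in this chart, and the angular momentum integral with respect to $Y$ diverges: the integrals $$\int_{r=\rho}\sum_{j,k}\overline\pi_{jk}Y^j\frac{x_k}{r}\,dS$$ diverge as $\rho\to\infty$.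
   Context: An initial data set is a 3-manifold $M$ with a Riemannian metric $g$ and symmetric $(0,2)$-tensor $K$; equivalently $(g,\pi)$ with $\pi=K-(\mathrm{tr}_gK)g$. It is vacuum if $R_g-|\pi|_g^2+\frac12(\mathrm{tr}_g\pi)^2=0$ and $\mathrm{div}_g\pi=0$. A vacuum initial data set is asymptotically flat at decay rate $q>1/2$ if outside a compact set $M$ is diffeomorphic to $\mathbb{R}^3\setminus B_1$ with a chart $\{x\}$ in which $g_{ij}=\delta_{ij}+O_2(r^{-q})$ and $K_{ij}=O_1(r^{-1-q})$, $r=|x|$. It satisfies the Regge–Teitelboim condition (in the chart $\{x\}$, at rate $q$) if moreover $g_{ij}(x)-g_{ij}(-x)=O_2(r^{-1-q})$ and $K_{ij}(x)+K_{ij}(-x)=O_1(r^{-2-q})$. $f=O_k(r^{-s})$ means $|\partial^\gamma f|\le Cr^{-s-|\gamma|}$ for all $|\gamma|\le k$ and large $r$. $dS$ is the standard Euclidean surface measure on $\{r=\rho\}$. The angular momentum with respect to a rotation vector field $Y$ is $\frac1{8\pi}\lim_{\rho\to\infty}$ of the integral in the claim (where the $\pi$ in the prefactor is the number). *)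

theory Defs
  imports "HOL-Analysis.Analysis"
begin

definition partial :: "3 \<Rightarrow> (real^3 \<Rightarrow> real) \<Rightarrow> real^3 \<Rightarrow> real" where
  "partial i f x = frechet_derivative f (at x) (axis i 1)"

text \<open>A list of indices of length \<open>m\<close> plays the role of a multi-index of order \<open>m\<close>.\<close>

primrec partials :: "3 list \<Rightarrow> (real^3 \<Rightarrow> real) \<Rightarrow> real^3 \<Rightarrow> real" where
  "partials [] f = f"
| "partials (i # is) f = partial i (partials is f)"

definition smooth_scalar_on :: "(real^3) set \<Rightarrow> (real^3 \<Rightarrow> real) \<Rightarrow> bool" where
  "smooth_scalar_on S f \<longleftrightarrow> (\<forall>is. \<forall>x\<in>S. partials is f differentiable (at x))"

text \<open>\<open>bigO_deriv k s f\<close> is \<open>f = O\<^sub>k(r\<^bsup>-s\<^esup>)\<close>. Since \<^const>\<open>frechet_derivative\<close> is total,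
  the existence of the derivatives that occur is demanded explicitly.\<close>

definition bigO_deriv :: "nat \<Rightarrow> real \<Rightarrow> (real^3 \<Rightarrow> real) \<Rightarrow> bool" where
  "bigO_deriv k s f \<longleftrightarrow>
     (\<exists>C R. \<forall>x. norm x > R \<longrightarrow>
        (\<forall>is. length is < k \<longrightarrow> partials is f differentiable (at x)) \<and>
        (\<forall>is. length is \<le> k \<longrightarrow>
           \<bar>partials is f x\<bar> \<le> C * norm x powr (- s - real (length is))))"

text \<open>The manifold is the whole type \<open>'m\<close>. A chart is a pair of its domain and its coordinate
  map; the values of the coordinate map off the domain are irrelevant.\<close>

type_synonym 'm chart = "'m set \<times> ('m \<Rightarrow> real^3)"

definition chart_image :: "'m chart \<Rightarrow> (real^3) set" where
  "chart_image c = snd c ` fst c"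

definition chart_inv :: "'m chart \<Rightarrow> real^3 \<Rightarrow> 'm" where
  "chart_inv c = inv_into (fst c) (snd c)"

definition is_chart :: "('m::topological_space) chart \<Rightarrow> bool" where
  "is_chart c \<longleftrightarrow> open (fst c) \<and> open (chart_image c) \<and>
     homeomorphism (fst c) (chart_image c) (snd c) (chart_inv c)"

definition transition :: "'m chart \<Rightarrow> 'm chart \<Rightarrow> real^3 \<Rightarrow> real^3" where
  "transition c d = snd d \<circ> chart_inv c"

definition smoothly_compatible :: "'m chart \<Rightarrow> 'm chart \<Rightarrow> bool" where
  "smoothly_compatible c d \<longleftrightarrow>
     (\<forall>i. smooth_scalar_on (snd c ` (fst c \<inter> fst d)) (\<lambda>x. transition c d x $ i)) \<and>
     (\<forall>i. smooth_scalar_on (snd d ` (fst c \<inter> fst d)) (\<lambda>x. transition d c x $ i))"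

definition smooth_structure ::
    "('m::{t2_space,second_countable_topology}) chart set \<Rightarrow> bool" where
  "smooth_structure \<A> \<longleftrightarrow>
     (\<forall>c\<in>\<A>. is_chart c) \<and> (\<Union>c\<in>\<A>. fst c) = UNIV \<and>
     (\<forall>c\<in>\<A>. \<forall>d\<in>\<A>. smoothly_compatible c d) \<and>
     (\<forall>c. is_chart c \<and> (\<forall>d\<in>\<A>. smoothly_compatible c d) \<longrightarrow> c \<in> \<A>)"

text \<open>A (0,2)-tensor field is given by its components in every chart, as functions on the image of
  the chart, subject to the tensorial transformation law.\<close>

type_synonym 'm tensor2 = "'m chart \<Rightarrow> real^3 \<Rightarrow> real^3^3"

definition smooth_tensor2 :: "'m chart set \<Rightarrow> 'm tensor2 \<Rightarrow> bool" where
  "smooth_tensor2 \<A> T \<longleftrightarrow>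
     (\<forall>c\<in>\<A>. \<forall>i j. smooth_scalar_on (chart_image c) (\<lambda>x. T c x $ i $ j)) \<and>
     (\<forall>c\<in>\<A>. \<forall>d\<in>\<A>. \<forall>x \<in> snd c ` (fst c \<inter> fst d). \<forall>i j.
        T c x $ i $ j =
          (\<Sum>k\<in>UNIV. \<Sum>l\<in>UNIV.
             partial i (\<lambda>y. transition c d y $ k) x * partial j (\<lambda>y. transition c d y $ l) x *
             T d (transition c d x) $ k $ l))"

definition symmetric_tensor2 :: "'m chart set \<Rightarrow> 'm tensor2 \<Rightarrow> bool" where
  "symmetric_tensor2 \<A> T \<longleftrightarrow>
     smooth_tensor2 \<A> T \<and> (\<forall>c\<in>\<A>. \<forall>x\<in>chart_image c. transpose (T c x) = T c x)"

definition riemannian_metric :: "'m chart set \<Rightarrow> 'm tensor2 \<Rightarrow> bool" where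
  "riemannian_metric \<A> g \<longleftrightarrow>
     symmetric_tensor2 \<A> g \<and>
     (\<forall>c\<in>\<A>. \<forall>x\<in>chart_image c. \<forall>v. v \<noteq> 0 \<longrightarrow> v \<bullet> (g c x *v v) > 0)"

text \<open>Here \<open>G\<close> and \<open>P\<close> are the component functions of a metric and of a symmetric (0,2)-tensor
  in one chart.\<close>

definition christoffel :: "(real^3 \<Rightarrow> real^3^3) \<Rightarrow> 3 \<Rightarrow> 3 \<Rightarrow> 3 \<Rightarrow> real^3 \<Rightarrow> real" where
  "christoffel G k i j x =
     1/2 * (\<Sum>l\<in>UNIV. matrix_inv (G x) $ k $ l *
       (partial i (\<lambda>y. G y $ j $ l) x + partial j (\<lambda>y. G y $ i $ l) x
        - partial l (\<lambda>y. G y $ i $ j) x))"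

definition ricci :: "(real^3 \<Rightarrow> real^3^3) \<Rightarrow> 3 \<Rightarrow> 3 \<Rightarrow> real^3 \<Rightarrow> real" where
  "ricci G i j x =
     (\<Sum>k\<in>UNIV. partial k (christoffel G k i j) x - partial j (christoffel G k i k) x) +
     (\<Sum>k\<in>UNIV. \<Sum>l\<in>UNIV.
        christoffel G k k l x * christoffel G l i j x
        - christoffel G k j l x * christoffel G l i k x)"

definition scalar_curvature :: "(real^3 \<Rightarrow> real^3^3) \<Rightarrow> real^3 \<Rightarrow> real" where
  "scalar_curvature G x = (\<Sum>i\<in>UNIV. \<Sum>j\<in>UNIV. matrix_inv (G x) $ i $ j * ricci G i j x)"

definition metric_trace ::
    "(real^3 \<Rightarrow> real^3^3) \<Rightarrow> (real^3 \<Rightarrow> real^3^3) \<Rightarrow> real^3 \<Rightarrow> real" where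
  "metric_trace G P x = (\<Sum>i\<in>UNIV. \<Sum>j\<in>UNIV. matrix_inv (G x) $ i $ j * P x $ i $ j)"

definition metric_norm_sq ::
    "(real^3 \<Rightarrow> real^3^3) \<Rightarrow> (real^3 \<Rightarrow> real^3^3) \<Rightarrow> real^3 \<Rightarrow> real" where
  "metric_norm_sq G P x =
     (\<Sum>i\<in>UNIV. \<Sum>j\<in>UNIV. \<Sum>k\<in>UNIV. \<Sum>l\<in>UNIV.
        matrix_inv (G x) $ i $ k * matrix_inv (G x) $ j $ l * P x $ i $ j * P x $ k $ l)"

text \<open>\<open>(div\<^sub>g P)\<^sub>j = g\<^bsup>kl\<^esup> \<nabla>\<^sub>k P\<^sub>l\<^sub>j\<close>.\<close>

definition metric_div ::
    "(real^3 \<Rightarrow> real^3^3) \<Rightarrow> (real^3 \<Rightarrow> real^3^3) \<Rightarrow> 3 \<Rightarrow> real^3 \<Rightarrow> real" where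
  "metric_div G P j x =
     (\<Sum>k\<in>UNIV. \<Sum>l\<in>UNIV. matrix_inv (G x) $ k $ l *
        (partial k (\<lambda>y. P y $ l $ j) x
         - (\<Sum>m\<in>UNIV. christoffel G m k l x * P x $ m $ j)
         - (\<Sum>m\<in>UNIV. christoffel G m k j x * P x $ l $ m)))"

definition initial_data_set ::
    "('m::{t2_space,second_countable_topology}) chart set \<Rightarrow> 'm tensor2 \<Rightarrow> 'm tensor2 \<Rightarrow> bool"
  where
  "initial_data_set \<A> g K \<longleftrightarrow>
     smooth_structure \<A> \<and> riemannian_metric \<A> g \<and> symmetric_tensor2 \<A> K"

definition momentum :: "'m tensor2 \<Rightarrow> 'm tensor2 \<Rightarrow> 'm tensor2" where
  "momentum g K = (\<lambda>c x. K c x - metric_trace (g c) (K c) x *\<^sub>R g c x)"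

definition vacuum_data ::
    "('m::{t2_space,second_countable_topology}) chart set \<Rightarrow> 'm tensor2 \<Rightarrow> 'm tensor2 \<Rightarrow> bool"
  where
  "vacuum_data \<A> g K \<longleftrightarrow> initial_data_set \<A> g K \<and>
     (\<forall>c\<in>\<A>. \<forall>x\<in>chart_image c.
        scalar_curvature (g c) x - metric_norm_sq (g c) (momentum g K c) x
          + 1/2 * (metric_trace (g c) (momentum g K c) x)\<^sup>2 = 0 \<and>
        (\<forall>j. metric_div (g c) (momentum g K c) j x = 0))"

text \<open>\<open>B\<^sub>1\<close> is the closed unit ball, so that its complement can be the image of a chart.\<close>

definition vacuum_af_data ::
    "('m::{t2_space,second_countable_topology}) chart set \<Rightarrow> 'm tensor2 \<Rightarrow> 'm tensor2 \<Rightarrow>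
     real \<Rightarrow> 'm chart \<Rightarrow> bool"
  where
  "vacuum_af_data \<A> g K q c \<longleftrightarrow>
     vacuum_data \<A> g K \<and> q > 1/2 \<and>
     c \<in> \<A> \<and> compact (- fst c) \<and> chart_image c = - cball 0 1 \<and>
     (\<forall>i j. bigO_deriv 2 q (\<lambda>x. g c x $ i $ j - (if i = j then 1 else 0))) \<and>
     (\<forall>i j. bigO_deriv 1 (1 + q) (\<lambda>x. K c x $ i $ j))"

definition regge_teitelboim ::
    "('m::{t2_space,second_countable_topology}) chart set \<Rightarrow> 'm tensor2 \<Rightarrow> 'm tensor2 \<Rightarrow>
     real \<Rightarrow> 'm chart \<Rightarrow> bool"
  where
  "regge_teitelboim \<A> g K q c \<longleftrightarrow>
     vacuum_af_data \<A> g K q c \<and>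
     (\<forall>i j. bigO_deriv 2 (1 + q) (\<lambda>x. g c x $ i $ j - g c (- x) $ i $ j)) \<and>
     (\<forall>i j. bigO_deriv 1 (2 + q) (\<lambda>x. K c x $ i $ j + K c (- x) $ i $ j))"

text \<open>The Euclidean surface measure on \<open>{r = \<rho>}\<close>: \<open>dS = \<rho>\<^sup>2 sin \<theta> d\<theta> d\<phi>\<close> in polar coordinates.\<close>

definition polar_point :: "real \<Rightarrow> real \<times> real \<Rightarrow> real^3" where
  "polar_point \<rho> = (\<lambda>(\<theta>, \<phi>).
     vector [\<rho> * sin \<theta> * cos \<phi>, \<rho> * sin \<theta> * sin \<phi>, \<rho> * cos \<theta>])"

definition sphere_measure :: "real \<Rightarrow> (real^3) measure" where
  "sphere_measure \<rho> =
     distr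
       (density (restrict_space lborel ({0..pi} \<times> {0..2*pi}))
          (\<lambda>(\<theta>, \<phi>). ennreal (\<rho>\<^sup>2 * sin \<theta>)))
       borel (polar_point \<rho>)"

text \<open>The integral is restricted to the sphere, which carries the measure, so that values of \<open>P\<close>
  off the sphere (and off the chart image) do not affect its integrability.\<close>

definition angular_flux :: "(real^3 \<Rightarrow> real^3^3) \<Rightarrow> (real^3 \<Rightarrow> real^3) \<Rightarrow> real \<Rightarrow> real" where
  "angular_flux P Y \<rho> =
     (LINT x:sphere 0 \<rho>|sphere_measure \<rho>.
        \<Sum>j\<in>UNIV. \<Sum>k\<in>UNIV. P x $ j $ k * Y x $ j * (x $ k / norm x))"

definition alpha :: "real^3 \<Rightarrow> real" where
  "alpha x = (x $ 1)\<^sup>2 / (norm x)\<^sup>2"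

definition beta :: "real^3 \<Rightarrow> real" where
  "beta x = x $ 1 * x $ 3 / (norm x)\<^sup>2"

definition rotation_field :: "real^3 \<Rightarrow> real^3" where
  "rotation_field x = x $ 3 *\<^sub>R axis 1 1 - x $ 1 *\<^sub>R axis 3 1"

end

theory Submission
  imports Defs "HOL-Library.Landau_Symbols"
begin

text \<open>Let \<open>Y\<close> be the rotation field and \<open>V\<^sub>k = \<Sum>\<^sub>j \<pi>\<^sub>j\<^sub>k Y\<^sup>j\<close>. Since \<open>Y \<bottom> x\<close>, the leading part of \<open>\<pi>\<close> does not
  contribute to the flux of \<open>V\<close> through \<open>{r = \<rho>}\<close> directly; the flux is controlled through its
  \<open>\<rho>\<close>-derivative, the integral of the Euclidean divergence of \<open>V\<close>. Expanding \<open>div\<^sub>g \<pi> = 0\<close> to second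
  order, that divergence equals \<open>\<beta>\<^sup>2/(2r\<^sup>3)\<close>, plus a term that is odd in \<open>x\<close> (from the constants
  \<open>B\<^sub>i\<close>) and integrates to zero, plus \<open>O(r\<^bsup>-3-q\<^esup>)\<close>. Hence the flux grows like \<open>c log \<rho>\<close> with
  \<open>c = \<integral>\<^bsub>S\<^sup>2\<^esub> \<beta>\<^sup>2/2 > 0\<close>. The parity condition fails because \<open>\<pi>\<^sub>1\<^sub>3(x) + \<pi>\<^sub>1\<^sub>3(-x)\<close> would be
  \<open>o(r\<^sup>-\<^sup>2)\<close>, whereas \<open>\<beta>\<close> is even; the component \<open>13\<close> is used because there the trace part
  \<open>(tr K) g\<^sub>1\<^sub>3\<close> decays faster than \<open>r\<^sup>-\<^sup>2\<close>.\<close>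

subsection \<open>Partial derivatives and functions of class C1\<close>

text \<open>Inserting the expansion of the momentum into the flux proves nothing: a remainder
  O(r^(-2-q)), multiplied by |Y| = O(r) and an area of order r^2, may contribute O(\<rho>^(1-q)),
  which for q < 1 swamps a logarithm. The constraint repairs this. It expresses \<partial>_k
  \<pi>_kj through products of h = g - \<delta> with \<partial>\<pi> and of \<partial>h with \<pi>,
  so the divergence of V is O(r^(-3)) with remainder O(r^(-3-q)); on spheres this means 1/\<rho>
  against the integrable \<rho>^(-1-q). Derivatives of Y drop out, since \<partial>_k Y^j is
  antisymmetric and \<pi> symmetric.

  The coefficient \<beta>^2/2 comes from half the contraction of the leading \<pi> with the Lie
  derivative of h along Y. That \<pi> is purely radial, so only the radial component of h counts, to
  leading order (A + \<alpha>/2)/r. Since Y r = 0 and Y \<alpha> = 2\<beta>, its Y-derivative is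
  \<beta>/r, and half the product with \<beta>/r^2 is \<beta>^2/(2r^3). The two angular functions
  are matched so that a square, hence a definite sign, results.\<close>

lemmas frechet_derivative_worksI = frechet_derivative_works[THEN iffD1]

lemma has_derivative_partials:
  assumes "f differentiable (at x)"
  shows "(f has_derivative (\<lambda>v. \<Sum>i\<in>UNIV. v $ i * partial i f x)) (at x)"
proof -
  let ?D = "frechet_derivative f (at x)"
  have D: "(f has_derivative ?D) (at x)"
    using assms frechet_derivative_works by blast
  then interpret bounded_linear ?D by (rule has_derivative_bounded_linear)
  have "?D v = (\<Sum>i\<in>UNIV. v $ i * partial i f x)" for v
  proof -
    have "?D v = ?D (\<Sum>i\<in>UNIV. v $ i *\<^sub>R axis i 1)"
      by (simp add: basis_expansion flip: scalar_mult_eq_scaleR)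
    then show ?thesis by (simp add: sum scaleR partial_def)
  qed
  then have "?D = (\<lambda>v. \<Sum>i\<in>UNIV. v $ i * partial i f x)" by blast
  with D show ?thesis by metis
qed

lemma partial_eqI: "(f has_derivative D) (at x) \<Longrightarrow> partial i f x = D (axis i 1)"
  by (metis frechet_derivative_at partial_def)

text \<open>Continuity of the derivatives is what integration over spheres and differentiation under
  the integral sign require. Differentiability is a separate clause because \<open>partial\<close>
  is total.\<close>

definition C1_on :: "(real^3) set \<Rightarrow> (real^3 \<Rightarrow> real) \<Rightarrow> bool" where
  "C1_on S f \<longleftrightarrow> (\<forall>x\<in>S. f differentiable (at x)) \<and> (\<forall>i. continuous_on S (partial i f))"

lemma C1_on_differentiable: "C1_on S f \<Longrightarrow> x \<in> S \<Longrightarrow> f differentiable (at x)"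
  by (simp add: C1_on_def)

lemma C1_on_continuous_partial: "C1_on S f \<Longrightarrow> continuous_on S (partial i f)"
  by (simp add: C1_on_def)

lemma C1_on_continuous: "C1_on S f \<Longrightarrow> continuous_on S f"
  by (simp add: C1_on_def continuous_at_imp_continuous_on differentiable_imp_continuous_within)

lemma C1_onI:
  assumes "\<And>x. x \<in> S \<Longrightarrow> (f has_derivative D x) (at x)"
    and "\<And>i. continuous_on S (\<lambda>x. D x (axis i 1))"
  shows "C1_on S f"
  unfolding C1_on_def
proof (intro conjI ballI allI)
  fix i
  show "continuous_on S (partial i f)"
    using assms(2)[of i] by (rule continuous_on_eq) (metis assms(1) partial_eqI)
qed (use assms(1) differentiable_def in blast)

lemma smooth_scalar_on_imp_C1_on: "smooth_scalar_on S f \<Longrightarrow> C1_on S f"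
  unfolding smooth_scalar_on_def C1_on_def
proof (intro conjI ballI allI)
  assume *: "\<forall>is. \<forall>x\<in>S. partials is f differentiable at x"
  show "f differentiable at x" if "x \<in> S" for x
    using *[rule_format, of x "[]"] that by simp
  show "continuous_on S (partial i f)" for i
    using *[rule_format, of _ "[i]"]
    by (simp add: continuous_at_imp_continuous_on differentiable_imp_continuous_within)
qed

lemma partial_const: "partial i (\<lambda>x. a) x = 0"
  by (rule partial_eqI) (rule has_derivative_const)

lemma partial_component: "partial i (\<lambda>x. x $ j) x = (if i = j then 1 else 0)"
proof -
  have "((\<lambda>x. x $ j) has_derivative (\<lambda>v. v $ j)) (at x)"
    by (rule bounded_linear.has_derivative[OF bounded_linear_vec_nth has_derivative_ident])
  from partial_eqI[OF this, of i] show ?thesis by (simp add: axis_def)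
qed

lemma partial_add:
  assumes "f differentiable (at x)" "g differentiable (at x)"
  shows "partial i (\<lambda>x. f x + g x) x = partial i f x + partial i g x"
  using partial_eqI[OF has_derivative_add[OF assms[THEN frechet_derivative_worksI]], of i]
  by (simp add: partial_def)

lemma partial_diff:
  assumes "f differentiable (at x)" "g differentiable (at x)"
  shows "partial i (\<lambda>x. f x - g x) x = partial i f x - partial i g x"
  using partial_eqI[OF has_derivative_diff[OF assms[THEN frechet_derivative_worksI]], of i]
  by (simp add: partial_def)

lemma partial_mult:
  assumes "f differentiable (at x)" "g differentiable (at x)"
  shows "partial i (\<lambda>x. f x * g x) x = f x * partial i g x + partial i f x * g x"
  using partial_eqI[OF has_derivative_mult[OF assms[THEN frechet_derivative_worksI]], of i]
  by (simp add: partial_def)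

lemma partial_sum:
  assumes "\<And>j. j \<in> I \<Longrightarrow> f j differentiable (at x)"
  shows "partial i (\<lambda>x. \<Sum>j\<in>I. f j x) x = (\<Sum>j\<in>I. partial i (f j) x)"
proof -
  have "((\<lambda>x. \<Sum>j\<in>I. f j x) has_derivative (\<lambda>v. \<Sum>j\<in>I. frechet_derivative (f j) (at x) v)) (at x)"
    by (intro has_derivative_sum frechet_derivative_worksI assms)
  from partial_eqI[OF this, of i] show ?thesis by (simp add: partial_def)
qed

lemma partial_cong:
  assumes "open S" "x \<in> S" "\<And>y. y \<in> S \<Longrightarrow> f y = g y"
  shows "partial i f x = partial i g x"
proof -
  have "(f has_derivative D) (at x) \<longleftrightarrow> (g has_derivative D) (at x)" for D
    using assms has_derivative_transform_within_open[of f D x UNIV S g]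
      has_derivative_transform_within_open[of g D x UNIV S f] by auto
  then show ?thesis by (simp add: partial_def frechet_derivative_def)
qed

text \<open>Chain rule for a dilation: with t > 0 it yields the homogeneity of derivatives, with t =
  -1 their parity.\<close>

lemma partial_scaleR_arg:
  assumes "f differentiable (at (t *\<^sub>R x))"
  shows "((\<lambda>x. f (t *\<^sub>R x)) differentiable (at x))"
    and "partial i (\<lambda>x. f (t *\<^sub>R x)) x = t * partial i f (t *\<^sub>R x)"
proof -
  have d: "((\<lambda>x. t *\<^sub>R x) has_derivative (\<lambda>v. t *\<^sub>R v)) (at x)"
    by (rule has_derivative_scaleR_right[OF has_derivative_ident])
  have c: "((\<lambda>x. f (t *\<^sub>R x)) has_derivative
      (\<lambda>v. frechet_derivative f (at (t *\<^sub>R x)) (t *\<^sub>R v))) (at x)"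
    by (rule has_derivative_compose[OF d frechet_derivative_worksI[OF assms]])
  then show "((\<lambda>x. f (t *\<^sub>R x)) differentiable (at x))"
    unfolding differentiable_def by blast
  have "linear (frechet_derivative f (at (t *\<^sub>R x)))"
    using assms by (rule linear_frechet_derivative)
  with partial_eqI[OF c] show "partial i (\<lambda>x. f (t *\<^sub>R x)) x = t * partial i f (t *\<^sub>R x)"
    by (simp add: partial_def linear_cmul)
qed

lemma C1_on_const [simp]: "C1_on S (\<lambda>x. a)"
  by (rule C1_onI[where D="\<lambda>x v. 0"]) auto

lemma C1_on_component [simp]: "C1_on S (\<lambda>x. x $ j)"
  by (rule C1_onI[where D="\<lambda>x v. v $ j"])
    (auto intro!: bounded_linear.has_derivative[OF bounded_linear_vec_nth has_derivative_ident])

lemma C1_on_add: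
  assumes "C1_on S f" "C1_on S g"
  shows "C1_on S (\<lambda>x. f x + g x)"
proof (rule C1_onI)
  show "((\<lambda>x. f x + g x) has_derivative
      (\<lambda>v. frechet_derivative f (at x) v + frechet_derivative g (at x) v)) (at x)" if "x \<in> S" for x
    using that assms by (intro has_derivative_add frechet_derivative_worksI C1_on_differentiable)
  show "continuous_on S (\<lambda>x. frechet_derivative f (at x) (axis i 1)
      + frechet_derivative g (at x) (axis i 1))" for i
    using assms[THEN C1_on_continuous_partial, of i]
    by (auto simp: partial_def[abs_def] intro: continuous_intros)
qed

lemma C1_on_diff:
  assumes "C1_on S f" "C1_on S g"
  shows "C1_on S (\<lambda>x. f x - g x)"
proof (rule C1_onI)
  show "((\<lambda>x. f x - g x) has_derivative
      (\<lambda>v. frechet_derivative f (at x) v - frechet_derivative g (at x) v)) (at x)" if "x \<in> S" for x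
    using that assms by (intro has_derivative_diff frechet_derivative_worksI C1_on_differentiable)
  show "continuous_on S (\<lambda>x. frechet_derivative f (at x) (axis i 1)
      - frechet_derivative g (at x) (axis i 1))" for i
    using assms[THEN C1_on_continuous_partial, of i]
    by (auto simp: partial_def[abs_def] intro: continuous_intros)
qed

lemma C1_on_mult:
  assumes "C1_on S f" "C1_on S g"
  shows "C1_on S (\<lambda>x. f x * g x)"
proof (rule C1_onI)
  show "((\<lambda>x. f x * g x) has_derivative
      (\<lambda>v. f x * frechet_derivative g (at x) v + frechet_derivative f (at x) v * g x)) (at x)"
    if "x \<in> S" for x
    using that assms by (intro has_derivative_mult frechet_derivative_worksI C1_on_differentiable)
  show "continuous_on S (\<lambda>x. f x * frechet_derivative g (at x) (axis i 1)
      + frechet_derivative f (at x) (axis i 1) * g x)" for i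
    using assms[THEN C1_on_continuous_partial, of i] assms[THEN C1_on_continuous]
    by (auto simp: partial_def[abs_def] intro: continuous_intros)
qed

lemma C1_on_inverse:
  assumes "C1_on S f" "\<And>x. x \<in> S \<Longrightarrow> f x \<noteq> 0"
  shows "C1_on S (\<lambda>x. inverse (f x))"
proof (rule C1_onI)
  show "((\<lambda>x. inverse (f x)) has_derivative
      (\<lambda>v. - (inverse (f x) * frechet_derivative f (at x) v * inverse (f x)))) (at x)"
    if "x \<in> S" for x
    using that assms
    by (intro Deriv.has_derivative_inverse frechet_derivative_worksI C1_on_differentiable) auto
  show "continuous_on S (\<lambda>x.
      - (inverse (f x) * frechet_derivative f (at x) (axis i 1) * inverse (f x)))" for i
    using C1_on_continuous_partial[OF assms(1), of i] C1_on_continuous[OF assms(1)] assms(2)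
    by (auto simp: partial_def[abs_def] intro!: continuous_intros)
qed

lemma C1_on_divide:
  assumes "C1_on S f" "C1_on S g" "\<And>x. x \<in> S \<Longrightarrow> g x \<noteq> 0"
  shows "C1_on S (\<lambda>x. f x / g x)"
  using C1_on_mult[OF assms(1) C1_on_inverse[OF assms(2,3)]] by (simp add: divide_inverse)

lemma C1_on_power: "C1_on S f \<Longrightarrow> C1_on S (\<lambda>x. f x ^ n)"
  by (induction n) (auto intro: C1_on_mult)

lemma C1_on_sum: "(\<And>i. i \<in> I \<Longrightarrow> C1_on S (f i)) \<Longrightarrow> C1_on S (\<lambda>x. \<Sum>i\<in>I. f i x)"
  by (induction I rule: infinite_finite_induct) (auto intro: C1_on_add)

lemma C1_on_norm: "0 \<notin> S \<Longrightarrow> C1_on S norm"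
proof (rule C1_onI)
  show "(norm has_derivative (\<lambda>v. v \<bullet> sgn x)) (at x)" if "0 \<notin> S" "x \<in> S" for x
    using that by (metis has_derivative_norm)
  show "continuous_on S (\<lambda>x. axis i 1 \<bullet> sgn x)" if "0 \<notin> S" for i
    using that by (auto simp: sgn_div_norm intro!: continuous_intros)
qed

lemmas C1_on_intros = C1_on_const C1_on_component C1_on_add C1_on_diff C1_on_mult C1_on_divide
  C1_on_power C1_on_sum C1_on_norm

lemma C1_on_cong:
  assumes "open S" "\<And>x. x \<in> S \<Longrightarrow> f x = g x"
  shows "C1_on S f \<longleftrightarrow> C1_on S g"
proof -
  have "C1_on S g" if f: "C1_on S f" and eq: "\<And>x. x \<in> S \<Longrightarrow> f x = g x" for f g
  proof (rule C1_onI)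
    show "(g has_derivative frechet_derivative f (at x)) (at x)" if "x \<in> S" for x
      using f eq that frechet_derivative_worksI[OF C1_on_differentiable[OF f that]]
        has_derivative_transform_within_open[OF _ assms(1) that] by blast
    show "continuous_on S (\<lambda>x. frechet_derivative f (at x) (axis i 1))" for i
      using C1_on_continuous_partial[OF f, of i] by (simp add: partial_def[abs_def])
  qed
  from this[of f g] this[of g f] assms(2) show ?thesis by auto
qed

subsection \<open>Integrals over coordinate spheres\<close>

abbreviation polar_box :: "(real \<times> real) set" where
  "polar_box \<equiv> cbox (0, 0) (pi, 2 * pi)"

text \<open>A gauge integral over the parameter rectangle gives direct access to iterated
  integration, the fundamental theorem of calculus and the Leibniz rule in the radius.\<close>

definition sphere_integral :: "(real^3 \<Rightarrow> real) \<Rightarrow> real \<Rightarrow> real" where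
  "sphere_integral f \<rho> =
     integral polar_box (\<lambda>z. \<rho>\<^sup>2 * sin (fst z) * f (polar_point \<rho> z))"

lemma polar_point_nth:
  "polar_point \<rho> z $ 1 = \<rho> * sin (fst z) * cos (snd z)"
  "polar_point \<rho> z $ 2 = \<rho> * sin (fst z) * sin (snd z)"
  "polar_point \<rho> z $ 3 = \<rho> * cos (fst z)"
  by (simp_all add: polar_point_def split_beta vector_3)

lemma polar_point_scaleR: "polar_point \<rho> z = \<rho> *\<^sub>R polar_point 1 z"
  by (simp add: vec_eq_iff forall_3 polar_point_nth)

lemma norm_polar_point: "norm (polar_point \<rho> z) = \<bar>\<rho>\<bar>"
proof -
  have "(norm (polar_point \<rho> z))\<^sup>2 = (\<rho> * sin (fst z) * cos (snd z))\<^sup>2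
      + (\<rho> * sin (fst z) * sin (snd z))\<^sup>2 + (\<rho> * cos (fst z))\<^sup>2"
    unfolding power2_norm_eq_inner inner_vec_def
    by (simp add: sum_3 polar_point_nth power2_eq_square)
  also have "\<dots> = \<rho>\<^sup>2"
    using sin_cos_squared_add[of "fst z"] sin_cos_squared_add[of "snd z"] by algebra
  finally show ?thesis
    by (metis norm_ge_zero real_sqrt_abs real_sqrt_unique)
qed

lemma continuous_on_polar_point [continuous_intros]:
  fixes f :: "'a::t2_space \<Rightarrow> real"
  assumes "continuous_on S f" "continuous_on S g"
  shows "continuous_on S (\<lambda>x. polar_point (f x) (g x))"
proof -
  have "continuous_on S (\<lambda>x. polar_point (f x) (g x) $ i)" for i
    using exhaust_3[of i] assms(1) continuous_on_fst[OF assms(2)] continuous_on_snd[OF assms(2)]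
    by (elim disjE) (simp_all add: polar_point_nth continuous_on_mult continuous_on_sin continuous_on_cos)
  then show ?thesis using continuous_on_vec_lambda[where f="\<lambda>i x. polar_point (f x) (g x) $ i"] by simp
qed

lemma continuous_on_compose_polar_point:
  assumes "continuous_on (sphere 0 \<rho>) f" "\<rho> \<ge> 0"
  shows "continuous_on S (\<lambda>z. f (polar_point \<rho> z))"
  by (rule continuous_on_compose2[OF assms(1)])
    (use assms(2) in \<open>auto intro!: continuous_intros simp: norm_polar_point\<close>)

lemma sphere_integrand_continuous:
  assumes "continuous_on (sphere 0 \<rho>) f" "\<rho> \<ge> 0"
  shows "continuous_on S (\<lambda>z. \<rho>\<^sup>2 * sin (fst z) * f (polar_point \<rho> z))"
  by (intro continuous_intros continuous_on_compose_polar_point assms)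

lemma sphere_integral_eq_lebesgue:
  assumes f: "continuous_on (sphere 0 \<rho>) f" and "\<rho> \<ge> 0"
  shows "(LINT x:sphere 0 \<rho>|sphere_measure \<rho>. f x) = sphere_integral f \<rho>"
proof -
  let ?g = "\<lambda>x. indicat_real (sphere 0 \<rho>) x * f x"
  let ?M = "restrict_space lborel ({0..pi} \<times> {0..2*pi}) :: (real \<times> real) measure"
  let ?D = "\<lambda>z :: real \<times> real. \<rho>\<^sup>2 * sin (fst z)"
  have box: "{0..pi} \<times> {0..2*pi} = polar_box"
    by (simp add: cbox_Pair_eq)
  \<comment> \<open>Only continuity on the sphere is known; extended by zero off this closed set,
    \<open>f\<close> becomes Borel measurable.\<close>
  have [measurable]: "?g \<in> borel_measurable borel"
    using borel_measurable_continuous_on_indicator[OF _ f] by simp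
  have [measurable]: "polar_point \<rho> \<in> borel_measurable borel"
    by (intro borel_measurable_continuous_onI continuous_intros)
  have D [measurable]: "?D \<in> borel_measurable borel"
    by (intro borel_measurable_continuous_onI continuous_intros)
  have meas: "g \<in> borel_measurable ?M" if "g \<in> borel_measurable borel" for g :: "_ \<Rightarrow> 'a::topological_space"
    using that by (intro measurable_restrict_space1) simp
  have "(LINT x:sphere 0 \<rho>|sphere_measure \<rho>. f x)
      = (\<integral>x. ?g x \<partial>distr (density ?M (\<lambda>z. ennreal (?D z))) borel (polar_point \<rho>))"
    by (simp add: set_lebesgue_integral_def sphere_measure_def split_beta')
  also have "\<dots> = (\<integral>z. ?g (polar_point \<rho> z) \<partial>density ?M (\<lambda>z. ennreal (?D z)))"
    by (rule integral_distr) (simp_all add: meas)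
  also have "\<dots> = (\<integral>z. ?D z *\<^sub>R ?g (polar_point \<rho> z) \<partial>?M)"
  proof (rule integral_density)
    show "AE z in ?M. 0 \<le> ?D z"
      by (rule AE_I2) (auto simp: space_restrict_space intro!: mult_nonneg_nonneg sin_ge_zero)
  qed (auto intro!: meas)
  also have "\<dots> = (LINT z:polar_box|lborel. ?D z * f (polar_point \<rho> z))"
    using \<open>\<rho> \<ge> 0\<close>
    by (simp add: integral_restrict_space box set_lebesgue_integral_def norm_polar_point)
  also have "\<dots> = sphere_integral f \<rho>"
    unfolding sphere_integral_def set_integrable_def
    by (intro set_borel_integral_eq_integral)
      (auto simp only: set_integrable_def intro!: borel_integrable_compact
        sphere_integrand_continuous assms compact_cbox)
  finally show ?thesis .
qed

lemma sphere_integral_add: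
  assumes "continuous_on (sphere 0 \<rho>) f" "continuous_on (sphere 0 \<rho>) g" "\<rho> \<ge> 0"
  shows "sphere_integral (\<lambda>x. f x + g x) \<rho> = sphere_integral f \<rho> + sphere_integral g \<rho>"
  using integral_add[of "\<lambda>z. \<rho>\<^sup>2 * sin (fst z) * f (polar_point \<rho> z)" polar_box
      "\<lambda>z. \<rho>\<^sup>2 * sin (fst z) * g (polar_point \<rho> z)"] assms
  by (simp add: sphere_integral_def distrib_left integrable_continuous sphere_integrand_continuous)

text \<open>Since |sin \<theta>| is at most 1, the constant can be the area 2 pi^2 of the parameter
  rectangle, in place of the sharp 4 pi.\<close>

lemma sphere_integral_abs_le:
  assumes f: "continuous_on (sphere 0 \<rho>) f" and "\<rho> \<ge> 0"
    and M: "\<And>x. norm x = \<rho> \<Longrightarrow> \<bar>f x\<bar> \<le> M"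
  shows "\<bar>sphere_integral f \<rho>\<bar> \<le> 2 * pi\<^sup>2 * \<rho>\<^sup>2 * M"
proof -
  have "norm (sphere_integral f \<rho>) \<le> (\<rho>\<^sup>2 * M) * measure lborel polar_box"
    unfolding sphere_integral_def
  proof (rule integrable_bound)
    have "0 \<le> M" using M[of "polar_point \<rho> 0"] \<open>\<rho> \<ge> 0\<close> by (simp add: norm_polar_point)
    then show "0 \<le> \<rho>\<^sup>2 * M" by simp
    show "norm (\<rho>\<^sup>2 * sin (fst z) * f (polar_point \<rho> z)) \<le> \<rho>\<^sup>2 * M" for z
    proof -
      have "\<bar>sin (fst z)\<bar> * \<bar>f (polar_point \<rho> z)\<bar> \<le> 1 * M"
        using M[of "polar_point \<rho> z"] \<open>\<rho> \<ge> 0\<close> by (intro mult_mono) (auto simp: norm_polar_point)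
      then show ?thesis by (simp add: abs_mult mult.assoc mult_left_mono)
    qed
  qed (intro integrable_continuous sphere_integrand_continuous f \<open>\<rho> \<ge> 0\<close>)
  then show ?thesis by (simp add: content_Pair power2_eq_square mult_ac)
qed

text \<open>In polar coordinates the antipodal map is (\<theta>, \<phi>) to (pi - \<theta>, \<phi> +
  pi). The shift in \<phi> is absorbed by 2 pi-periodicity, and the reflection in \<theta> preserves
  sin \<theta>, so the integral equals its own negative.\<close>

lemma sphere_integral_odd:
  assumes f: "continuous_on (sphere 0 \<rho>) f" and "\<rho> \<ge> 0"
    and odd: "\<And>x. norm x = \<rho> \<Longrightarrow> f (- x) = - f x"
  shows "sphere_integral f \<rho> = 0"
proof -
  define g where "g \<theta> \<phi> = f (polar_point \<rho> (\<theta>, \<phi>))" for \<theta> \<phi>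
  define H where "H \<theta> = integral {0..2 * pi} (g \<theta>)" for \<theta>
  have g: "continuous_on S (g \<theta>)" for S \<theta>
    unfolding g_def by (rule continuous_on_compose2[OF f])
      (use \<open>\<rho> \<ge> 0\<close> in \<open>auto intro!: continuous_intros simp: norm_polar_point\<close>)
  have int: "g \<theta> integrable_on {a..b}" for \<theta> a b
    by (rule integrable_continuous_real[OF g])
  have sph: "sphere_integral f \<rho> = integral {0..pi} (\<lambda>\<theta>. \<rho>\<^sup>2 * sin \<theta> * H \<theta>)"
    unfolding sphere_integral_def H_def g_def
    by (subst integral_prod_continuous)
      (use sphere_integrand_continuous[OF f \<open>\<rho> \<ge> 0\<close>] in auto)
  have refl: "g (pi - \<theta>) \<phi> = - g \<theta> (\<phi> + pi)" for \<theta> \<phi>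
  proof -
    have "polar_point \<rho> (pi - \<theta>, \<phi>) = - polar_point \<rho> (\<theta>, \<phi> + pi)"
      by (simp add: vec_eq_iff forall_3 polar_point_nth)
    then show ?thesis
      using odd[of "polar_point \<rho> (\<theta>, \<phi> + pi)"] \<open>\<rho> \<ge> 0\<close> by (simp add: g_def norm_polar_point)
  qed
  have per: "g \<theta> (\<phi> + 2 * pi) = g \<theta> \<phi>" for \<theta> \<phi>
    by (simp add: g_def polar_point_def)
  have shift: "integral {a..b} (\<lambda>\<phi>. g \<theta> (\<phi> + c)) = integral {a+c..b+c} (g \<theta>)" for \<theta> a b c
    using integral_shift[of a c b "g \<theta>"] g by (simp add: o_def add.commute)
  have H: "H (pi - \<theta>) = - H \<theta>" for \<theta>
  proof -
    have "integral {0..2*pi} (\<lambda>\<phi>. g \<theta> (\<phi> + pi)) = integral {pi..2*pi+pi} (g \<theta>)"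
      by (simp add: shift)
    also have "\<dots> = integral {pi..2*pi} (g \<theta>) + integral {2*pi..2*pi+pi} (g \<theta>)"
      by (rule Henstock_Kurzweil_Integration.integral_combine[symmetric]) (auto intro: int)
    also have "integral {2*pi..2*pi+pi} (g \<theta>) = integral {0..pi} (\<lambda>\<phi>. g \<theta> (\<phi> + 2*pi))"
      by (simp add: shift add.commute)
    also have "integral {pi..2*pi} (g \<theta>) + \<dots> = integral {0..pi} (g \<theta>) + integral {pi..2*pi} (g \<theta>)"
      by (simp add: per)
    also have "\<dots> = H \<theta>"
      unfolding H_def by (rule Henstock_Kurzweil_Integration.integral_combine) (auto intro: int)
    finally show ?thesis
      unfolding H_def refl by simp
  qed
  \<comment> \<open>The substitution of pi - \<theta> for \<theta> is carried out as a reflection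
    followed by a translation.\<close>
  have "integral {0..pi} (\<lambda>\<theta>. \<rho>\<^sup>2 * sin \<theta> * H \<theta>)
      = integral {-pi..0} (\<lambda>\<theta>. \<rho>\<^sup>2 * sin (- \<theta>) * H (- \<theta>))"
    using Henstock_Kurzweil_Integration.integral_reflect_real[where a=0 and b=pi and f="\<lambda>\<theta>. \<rho>\<^sup>2 * sin \<theta> * H \<theta>"]
    by (simp only: minus_zero)
  also have "\<dots> = integral {-pi+pi..0+pi} (\<lambda>\<theta>. \<rho>\<^sup>2 * sin (pi - \<theta>) * H (pi - \<theta>))"
    by (subst integral_shift_real_ivl[symmetric, where c=pi]) simp
  also have "\<dots> = - integral {0..pi} (\<lambda>\<theta>. \<rho>\<^sup>2 * sin \<theta> * H \<theta>)"
    by (simp add: H)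
  finally show ?thesis by (simp add: sph)
qed

section \<open>The polar frame and the radial derivative of a flux\<close>

definition polar_theta :: "real \<times> real \<Rightarrow> real^3" where
  "polar_theta z = vector [cos (fst z) * cos (snd z), cos (fst z) * sin (snd z), - sin (fst z)]"

text \<open>Normalized, that is, without the factor sin \<theta> of the coordinate derivative; so it
  is defined and smooth at the poles of the parameter rectangle too.\<close>

definition polar_phi :: "real \<times> real \<Rightarrow> real^3" where
  "polar_phi z = vector [- sin (snd z), cos (snd z), 0]"

lemma polar_theta_nth:
  "polar_theta z $ 1 = cos (fst z) * cos (snd z)"
  "polar_theta z $ 2 = cos (fst z) * sin (snd z)"
  "polar_theta z $ 3 = - sin (fst z)"
  by (simp_all add: polar_theta_def vector_3)

lemma polar_phi_nth:
  "polar_phi z $ 1 = - sin (snd z)" "polar_phi z $ 2 = cos (snd z)" "polar_phi z $ 3 = 0"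
  by (simp_all add: polar_phi_def vector_3)

lemma continuous_on_polar_theta_nth: "continuous_on S (\<lambda>z. polar_theta z $ k)"
  using exhaust_3[of k]
  by (elim disjE) (auto simp: polar_theta_nth intro!: continuous_intros)

lemma continuous_on_polar_phi_nth: "continuous_on S (\<lambda>z. polar_phi z $ k)"
  using exhaust_3[of k]
  by (elim disjE) (auto simp: polar_phi_nth intro!: continuous_intros)

lemma continuous_on_polar_point_nth: "continuous_on S (\<lambda>z. polar_point \<rho> z $ k)"
  using exhaust_3[of k]
  by (elim disjE) (auto simp: polar_point_nth intro!: continuous_intros)

text \<open>The radial, \<theta> and \<phi> unit vectors form an orthonormal frame and so resolve
  the identity. Applied to a gradient, this splits a Cartesian derivative into its radial and two
  angular parts.\<close>

lemma polar_frame_complete: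
  "polar_point 1 z $ k * polar_point 1 z $ i + polar_theta z $ k * polar_theta z $ i
     + polar_phi z $ k * polar_phi z $ i = (if i = k then 1 else 0)"
proof -
  let ?L = "\<lambda>k i. polar_point 1 z $ k * polar_point 1 z $ i + polar_theta z $ k * polar_theta z $ i
     + polar_phi z $ k * polar_phi z $ i"
  have sc: "(sin (fst z))\<^sup>2 + (cos (fst z))\<^sup>2 = 1" "(sin (snd z))\<^sup>2 + (cos (snd z))\<^sup>2 = 1"
    by simp_all
  have "?L 1 1 = 1" "?L 1 2 = 0"
    unfolding polar_point_nth polar_theta_nth polar_phi_nth using sc by algebra+
  moreover have "?L 1 3 = 0" "?L 2 3 = 0"
    by (simp_all add: polar_point_nth polar_theta_nth polar_phi_nth)
  moreover have "?L 2 2 = 1" "?L 3 3 = 1"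
    unfolding polar_point_nth polar_theta_nth polar_phi_nth using sc by algebra+
  moreover from calculation have "?L 2 1 = 0" "?L 3 1 = 0" "?L 3 2 = 0"
    by (simp_all only: mult.commute)
  ultimately show ?thesis
    using exhaust_3[of k] exhaust_3[of i] by (elim disjE) simp_all
qed

lemma polar_point_has_derivative_radius:
  "((\<lambda>\<rho>. polar_point \<rho> z $ k) has_real_derivative polar_point 1 z $ k) (at \<rho> within S)"
  using exhaust_3[of k]
  by (elim disjE) (auto simp: polar_point_nth intro!: derivative_eq_intros)

lemma polar_point_has_derivative_theta:
  "((\<lambda>\<theta>. polar_point \<rho> (\<theta>, \<phi>) $ k) has_real_derivative \<rho> * polar_theta (\<theta>, \<phi>) $ k)
     (at \<theta> within S)"
  using exhaust_3[of k]
  by (elim disjE) (auto simp: polar_point_nth polar_theta_nth intro!: derivative_eq_intros)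

lemma polar_point_has_derivative_phi:
  "((\<lambda>\<phi>. polar_point \<rho> (\<theta>, \<phi>) $ k) has_real_derivative \<rho> * sin \<theta> * polar_phi (\<theta>, \<phi>) $ k)
     (at \<phi> within S)"
  using exhaust_3[of k]
  by (elim disjE) (auto simp: polar_point_nth polar_phi_nth intro!: derivative_eq_intros)

lemma polar_theta_has_derivative_theta:
  "((\<lambda>\<theta>. polar_theta (\<theta>, \<phi>) $ k) has_real_derivative - (polar_point 1 (\<theta>, \<phi>) $ k))
     (at \<theta> within S)"
  using exhaust_3[of k]
  by (elim disjE) (auto simp: polar_point_nth polar_theta_nth intro!: derivative_eq_intros)

lemma polar_phi_has_derivative_phi:
  "((\<lambda>\<phi>. polar_phi (\<theta>, \<phi>) $ k) has_real_derivative
      - (sin \<theta> * polar_point 1 (\<theta>, \<phi>) $ k + cos \<theta> * polar_theta (\<theta>, \<phi>) $ k)) (at \<phi> within S)"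
proof -
  have sc: "(sin \<theta>)\<^sup>2 + (cos \<theta>)\<^sup>2 = 1" by simp
  show ?thesis
    using exhaust_3[of k]
  proof (elim disjE)
    assume [simp]: "k = 1"
    have "- (sin \<theta> * (sin \<theta> * cos \<phi>) + cos \<theta> * (cos \<theta> * cos \<phi>)) = - cos \<phi>"
      using sc by algebra
    then show ?thesis
      by (auto simp: polar_point_nth polar_theta_nth polar_phi_nth intro!: derivative_eq_intros)
  next
    assume [simp]: "k = 2"
    have "- (sin \<theta> * (sin \<theta> * sin \<phi>) + cos \<theta> * (cos \<theta> * sin \<phi>)) = - sin \<phi>"
      using sc by algebra
    then show ?thesis
      by (auto simp: polar_point_nth polar_theta_nth polar_phi_nth intro!: derivative_eq_intros)
  qed (auto simp: polar_point_nth polar_theta_nth polar_phi_nth intro!: derivative_eq_intros)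
qed

lemma has_real_derivative_along_curve:
  assumes f: "f differentiable (at (\<gamma> t))"
    and \<gamma>: "\<And>i. ((\<lambda>t. \<gamma> t $ i) has_real_derivative \<gamma>' $ i) (at t within S)"
  shows "((\<lambda>t. f (\<gamma> t)) has_real_derivative (\<Sum>i\<in>UNIV. \<gamma>' $ i * partial i f (\<gamma> t))) (at t within S)"
proof -
  have "(\<gamma> has_derivative (\<lambda>h. h *\<^sub>R \<gamma>')) (at t within S)"
  proof (subst has_derivative_componentwise_within, rule ballI)
    fix b :: "real^3" assume "b \<in> Basis"
    then obtain i where b: "b = axis i 1" by (auto simp: Basis_vec_def)
    have "(\<lambda>h. (h *\<^sub>R \<gamma>') \<bullet> b) = (*) (\<gamma>' $ i)"
      by (rule ext) (simp add: b inner_axis)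
    with \<gamma>[of i] show "((\<lambda>x. \<gamma> x \<bullet> b) has_derivative (\<lambda>h. (h *\<^sub>R \<gamma>') \<bullet> b)) (at t within S)"
      by (simp add: b inner_axis has_field_derivative_def)
  qed
  from has_derivative_compose[OF this has_derivative_partials[OF f]]
  have "((\<lambda>t. f (\<gamma> t)) has_derivative
      (\<lambda>h. \<Sum>i\<in>UNIV. (h *\<^sub>R \<gamma>') $ i * partial i f (\<gamma> t))) (at t within S)" .
  also have "(\<lambda>h. \<Sum>i\<in>UNIV. (h *\<^sub>R \<gamma>') $ i * partial i f (\<gamma> t))
      = (*) (\<Sum>i\<in>UNIV. \<gamma>' $ i * partial i f (\<gamma> t))"
    by (rule ext) (simp add: sum_distrib_left mult_ac)
  finally show ?thesis by (simp add: has_field_derivative_def)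
qed

text \<open>The integrand of \<open>d/d\<rho> \<integral>\<^bsub>r=\<rho>\<^esub> f n\<^sub>k dS - \<integral>\<^bsub>r=\<rho>\<^esub> \<partial>\<^sub>k f dS\<close> is
  \<open>-\<rho> (\<partial>\<^sub>\<theta> (sin \<theta> e\<^sub>\<theta> f) + \<partial>\<^sub>\<phi> (e\<^sub>\<phi> f))\<close>, componentwise.\<close>

lemma sphere_integral_tangential_eq_0:
  assumes C1: "C1_on (- cball 0 R) f" and R: "0 \<le> R" "R < \<rho>"
  shows "integral polar_box (\<lambda>z.
      (cos (fst z) * polar_theta z $ k - sin (fst z) * polar_point 1 z $ k) * f (polar_point \<rho> z)
      + sin (fst z) * polar_theta z $ k *
          (\<Sum>i\<in>UNIV. \<rho> * polar_theta z $ i * partial i f (polar_point \<rho> z))) = 0" (is "integral _ ?f = 0")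
    and "integral polar_box (\<lambda>z.
      - (sin (fst z) * polar_point 1 z $ k + cos (fst z) * polar_theta z $ k) * f (polar_point \<rho> z)
      + polar_phi z $ k *
          (\<Sum>i\<in>UNIV. \<rho> * sin (fst z) * polar_phi z $ i * partial i f (polar_point \<rho> z))) = 0"
      (is "integral _ ?g = 0")
proof -
  have mem: "polar_point \<rho> z \<in> - cball 0 R" for z
    using R by (simp add: norm_polar_point)
  have sub: "sphere (0::real^3) \<rho> \<subseteq> - cball 0 R" using R by auto
  have diff: "f differentiable (at (polar_point \<rho> z))" for z
    using C1 mem by (rule C1_on_differentiable)
  have cont: "continuous_on S (\<lambda>z. f (polar_point \<rho> z))"
    "continuous_on S (\<lambda>z. partial i f (polar_point \<rho> z))" for S i
    using C1_on_continuous[OF C1] C1_on_continuous_partial[OF C1] sub R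
    by (auto intro!: continuous_on_compose_polar_point intro: continuous_on_subset)
  note cs = continuous_intros continuous_on_polar_theta_nth continuous_on_polar_phi_nth
    continuous_on_polar_point_nth cont
  define ff where "ff = ?f"
  define gg where "gg = ?g"
  have fc: "continuous_on polar_box ff" and gc: "continuous_on polar_box gg"
    unfolding ff_def gg_def by (intro cs)+
  have "((\<lambda>\<theta>. ff (\<theta>, \<phi>)) has_integral 0) {0..pi}" for \<phi>
  proof -
    \<comment> \<open>The antiderivative vanishes at both poles because of its factor sin
      \<theta>.\<close>
    define F where "F \<theta> = sin \<theta> * polar_theta (\<theta>, \<phi>) $ k * f (polar_point \<rho> (\<theta>, \<phi>))" for \<theta>
    have "((\<lambda>\<theta>. ff (\<theta>, \<phi>)) has_integral F pi - F 0) {0..pi}"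
    proof (rule fundamental_theorem_of_calculus)
      fix \<theta> :: real
      have 1: "((\<lambda>\<theta>. f (polar_point \<rho> (\<theta>, \<phi>))) has_real_derivative
          (\<Sum>i\<in>UNIV. (\<rho> *\<^sub>R polar_theta (\<theta>, \<phi>)) $ i * partial i f (polar_point \<rho> (\<theta>, \<phi>))))
          (at \<theta> within {0..pi})"
        by (rule has_real_derivative_along_curve[where \<gamma>="\<lambda>\<theta>. polar_point \<rho> (\<theta>, \<phi>)"])
          (simp_all add: diff polar_point_has_derivative_theta)
      show "(F has_vector_derivative ff (\<theta>, \<phi>)) (at \<theta> within {0..pi})"
        unfolding F_def ff_def gg_def has_real_derivative_iff_has_vector_derivative[symmetric]
        by (rule derivative_eq_intros refl 1 polar_theta_has_derivative_theta)+
          (simp add: algebra_simps)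
    qed simp
    then show ?thesis by (simp add: F_def)
  qed
  then have "integral {0..pi} (\<lambda>\<theta>. ff (\<theta>, \<phi>)) = 0" for \<phi>
    by (rule integral_unique)
  \<comment> \<open>The order of integration is exchanged so that the inner integral runs over
    \<theta>, the variable of the total derivative.\<close>
  moreover have "integral polar_box ff = integral (cbox (0,0) (2 * pi, pi)) (\<lambda>(\<phi>, \<theta>). ff (\<theta>, \<phi>))"
    using integral_swap_2dim[of 0 0 pi "2 * pi" "\<lambda>\<theta> \<phi>. ff (\<theta>, \<phi>)"] fc by (simp add: split_beta')
  moreover have "integral (cbox (0,0) (2 * pi, pi)) (\<lambda>(\<phi>, \<theta>). ff (\<theta>, \<phi>)) =
      integral {0..2*pi} (\<lambda>\<phi>. integral {0..pi} (\<lambda>\<theta>. ff (\<theta>, \<phi>)))"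
  proof -
    have "continuous_on (cbox (0,0) (2 * pi, pi)) (\<lambda>(\<phi>, \<theta>). ff (\<theta>, \<phi>))"
      using swap_continuous[of 0 0 pi "2 * pi" "\<lambda>\<theta> \<phi>. ff (\<theta>, \<phi>)"] fc by (simp add: split_beta')
    from integral_prod_continuous[OF this] show ?thesis by simp
  qed
  ultimately show "integral polar_box ?f = 0" by (simp flip: ff_def)
  have "((\<lambda>\<phi>. gg (\<theta>, \<phi>)) has_integral 0) {0..2*pi}" for \<theta>
  proof -
    \<comment> \<open>Here the boundary values do not vanish, but they agree by 2 pi-periodicity in
      \<phi>.\<close>
    define F where "F \<phi> = polar_phi (\<theta>, \<phi>) $ k * f (polar_point \<rho> (\<theta>, \<phi>))" for \<phi>
    have "((\<lambda>\<phi>. gg (\<theta>, \<phi>)) has_integral F (2*pi) - F 0) {0..2*pi}"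
    proof (rule fundamental_theorem_of_calculus)
      fix \<phi> :: real
      have 1: "((\<lambda>\<phi>. f (polar_point \<rho> (\<theta>, \<phi>))) has_real_derivative
          (\<Sum>i\<in>UNIV. ((\<rho> * sin \<theta>) *\<^sub>R polar_phi (\<theta>, \<phi>)) $ i * partial i f (polar_point \<rho> (\<theta>, \<phi>))))
          (at \<phi> within {0..2*pi})"
        by (rule has_real_derivative_along_curve[where \<gamma>="\<lambda>\<phi>. polar_point \<rho> (\<theta>, \<phi>)"])
          (simp_all add: diff polar_point_has_derivative_phi)
      show "(F has_vector_derivative gg (\<theta>, \<phi>)) (at \<phi> within {0..2*pi})"
        unfolding F_def ff_def gg_def has_real_derivative_iff_has_vector_derivative[symmetric]
        by (rule derivative_eq_intros refl 1 polar_phi_has_derivative_phi)+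
          (simp add: algebra_simps)
    qed simp
    moreover have "F (2*pi) = F 0"
      by (simp add: F_def polar_phi_def polar_point_def)
    ultimately show ?thesis by simp
  qed
  then have "integral {0..2*pi} (\<lambda>\<phi>. gg (\<theta>, \<phi>)) = 0" for \<theta>
    by (rule integral_unique)
  then show "integral polar_box ?g = 0"
    unfolding gg_def[symmetric] by (simp add: integral_prod_continuous[OF gc])
qed

text \<open>The divergence theorem in differential form, one Cartesian component at a time.
  Differentiating under the integral produces the radial part of the gradient and a multiple of f
  itself; what is missing from the Cartesian derivative is a total angular derivative, which
  integrates to zero. No volume integral occurs.\<close>

lemma has_real_derivative_sphere_integral:
  assumes C1: "C1_on (- cball 0 R) f" and R: "0 \<le> R" "R < \<rho>"
  shows "(sphere_integral (\<lambda>x. f x * (x $ k / norm x)) has_real_derivative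
      sphere_integral (partial k f) \<rho>) (at \<rho>)"
proof -
  let ?n = "\<lambda>z. polar_point 1 z $ k"
  define h where "h \<rho> z = \<rho>\<^sup>2 * sin (fst z) * (f (polar_point \<rho> z) * ?n z)" for \<rho> z
  define h' where "h' \<rho> z = 2 * \<rho> * sin (fst z) * (f (polar_point \<rho> z) * ?n z)
    + \<rho>\<^sup>2 * sin (fst z) *
       ((\<Sum>i\<in>UNIV. polar_point 1 z $ i * partial i f (polar_point \<rho> z)) * ?n z)" for \<rho> z
  have mem: "polar_point t z \<in> - cball 0 R" if "t \<in> {R<..}" for t z
    using R that by (simp add: norm_polar_point)
  have cont2: "continuous_on ({R<..} \<times> polar_box) (\<lambda>p. g (polar_point (fst p) (snd p)))"
    if "continuous_on (- cball 0 R) g" for g :: "real^3 \<Rightarrow> real"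
    by (rule continuous_on_compose2[OF that])
      (use R in \<open>auto intro!: continuous_intros simp: norm_polar_point\<close>)
  have n2: "continuous_on S (\<lambda>p. polar_point 1 (snd p) $ i)" for S :: "(real \<times> (real \<times> real)) set" and i
    by (rule continuous_on_compose2[OF continuous_on_polar_point_nth continuous_on_snd]) auto
  note cs = continuous_intros n2 cont2 C1_on_continuous[OF C1] C1_on_continuous_partial[OF C1]
  have h'c: "continuous_on ({R<..} \<times> polar_box) (\<lambda>(\<rho>, z). h' \<rho> z)"
    unfolding h'_def split_beta by (intro cs)
  have hc: "continuous_on ({R<..} \<times> polar_box) (\<lambda>(\<rho>, z). h \<rho> z)"
    unfolding h_def split_beta by (intro cs)
  have slice: "continuous_on polar_box (g t)"
    if "continuous_on ({R<..} \<times> polar_box) (\<lambda>(\<rho>, z). g \<rho> z)" "t > R" for g :: "real \<Rightarrow> real \<times> real \<Rightarrow> real" and t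
    using continuous_on_compose2[OF that(1) continuous_on_Pair[OF continuous_on_const continuous_on_id], of t polar_box] that(2)
    by (force simp: image_subset_iff)
  have deriv: "((\<lambda>\<rho>. h \<rho> z) has_real_derivative h' t z) (at t within {R<..})"
    if "t \<in> {R<..}" for t z
  proof -
    have 1: "((\<lambda>\<rho>. f (polar_point \<rho> z)) has_real_derivative
        (\<Sum>i\<in>UNIV. polar_point 1 z $ i * partial i f (polar_point t z))) (at t within {R<..})"
      by (rule has_real_derivative_along_curve[where \<gamma>="\<lambda>\<rho>. polar_point \<rho> z"])
        (auto intro: C1_on_differentiable[OF C1 mem[OF that]] polar_point_has_derivative_radius)
    show ?thesis
      unfolding h_def h'_def
      by (rule derivative_eq_intros refl 1)+ (simp add: algebra_simps)
  qed
  have "((\<lambda>\<rho>. integral polar_box (h \<rho>)) has_real_derivative integral polar_box (h' \<rho>))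
      (at \<rho> within {R<..})"
    by (rule leibniz_rule_field_derivative[OF deriv _ h'c])
      (use R in \<open>auto intro!: integrable_continuous slice[OF hc]\<close>)
  then have D: "((\<lambda>\<rho>. integral polar_box (h \<rho>)) has_real_derivative integral polar_box (h' \<rho>)) (at \<rho>)"
    using R by (simp add: at_within_open[of \<rho> "{R<..}"])
  have eq: "integral polar_box (h t) = sphere_integral (\<lambda>x. f x * (x $ k / norm x)) t" if "t \<in> {R<..}" for t
    using that R unfolding sphere_integral_def h_def
    by (intro arg_cong[where f="integral _"] ext)
      (simp add: norm_polar_point, subst (3) polar_point_scaleR, simp)
  have "integral polar_box (h' \<rho>) = sphere_integral (partial k f) \<rho>"
  proof -
    define T1 where "T1 z =
      (cos (fst z) * polar_theta z $ k - sin (fst z) * ?n z) * f (polar_point \<rho> z)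
      + sin (fst z) * polar_theta z $ k *
          (\<Sum>i\<in>UNIV. \<rho> * polar_theta z $ i * partial i f (polar_point \<rho> z))" for z
    define T2 where "T2 z =
      - (sin (fst z) * ?n z + cos (fst z) * polar_theta z $ k) * f (polar_point \<rho> z)
      + polar_phi z $ k *
          (\<Sum>i\<in>UNIV. \<rho> * sin (fst z) * polar_phi z $ i * partial i f (polar_point \<rho> z))" for z
    have sub: "sphere (0::real^3) \<rho> \<subseteq> - cball 0 R" using R by auto
    have cont: "continuous_on S (\<lambda>z. f (polar_point \<rho> z))"
      "continuous_on S (\<lambda>z. partial i f (polar_point \<rho> z))" for S i
      using C1_on_continuous[OF C1] C1_on_continuous_partial[OF C1] sub R
      by (auto intro!: continuous_on_compose_polar_point intro: continuous_on_subset)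
    note cs = continuous_intros continuous_on_polar_theta_nth continuous_on_polar_phi_nth
      continuous_on_polar_point_nth cont
    have T: "T1 integrable_on polar_box" "T2 integrable_on polar_box"
      unfolding T1_def T2_def by (intro integrable_continuous cs)+
    have "integral polar_box T1 = 0" "integral polar_box T2 = 0"
      unfolding T1_def T2_def using C1 R by (rule sphere_integral_tangential_eq_0)+
    then have T0: "integral polar_box (\<lambda>z. \<rho> * (T1 z + T2 z)) = 0"
      using T by (simp add: integral_add)
    \<comment> \<open>The undifferentiated terms cancel: the derivative of
      \<open>\<rho>\<^sup>2\<close> leaves 2 \<rho> sin \<theta> n_k f in \<open>h'\<close>, while
      \<open>T1\<close> and \<open>T2\<close> each contribute -sin \<theta> n_k f and opposite
      multiples of cos \<theta> e_\<theta> f. The remaining gradient terms are matched by the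
      completeness of the frame.\<close>
    have pw: "\<rho>\<^sup>2 * sin (fst z) * partial k f (polar_point \<rho> z) = h' \<rho> z + \<rho> * (T1 z + T2 z)" for z
    proof -
      have "partial k f (polar_point \<rho> z)
          = (\<Sum>i\<in>UNIV. (if i = k then 1 else 0) * partial i f (polar_point \<rho> z))"
        by (simp add: if_distrib[of "\<lambda>a. a * _"] cong: if_cong)
      also have "\<dots> = (\<Sum>i\<in>UNIV. (?n z * polar_point 1 z $ i + polar_theta z $ k * polar_theta z $ i
          + polar_phi z $ k * polar_phi z $ i) * partial i f (polar_point \<rho> z))"
        by (simp only: polar_frame_complete)
      also have "\<dots> =
          ?n z * (\<Sum>i\<in>UNIV. polar_point 1 z $ i * partial i f (polar_point \<rho> z))
          + polar_theta z $ k * (\<Sum>i\<in>UNIV. polar_theta z $ i * partial i f (polar_point \<rho> z))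
          + polar_phi z $ k * (\<Sum>i\<in>UNIV. polar_phi z $ i * partial i f (polar_point \<rho> z))"
        by (simp add: sum_distrib_left sum.distrib algebra_simps)
      finally have p: "partial k f (polar_point \<rho> z) = \<dots>" .
      show ?thesis
        unfolding p h'_def T1_def T2_def sum_3 by (simp add: algebra_simps power2_eq_square)
    qed
    have "sphere_integral (partial k f) \<rho> = integral polar_box (\<lambda>z. h' \<rho> z + \<rho> * (T1 z + T2 z))"
      unfolding sphere_integral_def pw ..
    also have "\<dots> = integral polar_box (h' \<rho>) + integral polar_box (\<lambda>z. \<rho> * (T1 z + T2 z))"
    proof (rule integral_add)
      show "h' \<rho> integrable_on polar_box"
        by (intro integrable_continuous slice[OF h'c] R)
      show "(\<lambda>z. \<rho> * (T1 z + T2 z)) integrable_on polar_box"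
        using integrable_on_cmult_left[OF integrable_add[OF T]] by simp
    qed
    finally show ?thesis using T0 by simp
  qed
  then have "((\<lambda>\<rho>. integral polar_box (h \<rho>)) has_real_derivative
      sphere_integral (partial k f) \<rho>) (at \<rho>)"
    using D by simp
  then show ?thesis
    by (rule has_field_derivative_transform_within_open[OF _ open_greaterThan]) (use R eq in auto)
qed

subsection \<open>Asymptotic expansions\<close>

text \<open>Exponents count growth rather than decay, the opposite of \<open>bigO_deriv\<close>: a
  bound at rate s there becomes exponent -s here.\<close>

abbreviation norm_bigo :: "real \<Rightarrow> (real^3 \<Rightarrow> real) set" where
  "norm_bigo s \<equiv> O[at_infinity](\<lambda>x. norm x powr s)"

lemma eventually_norm_gt_at_infinity:
  "eventually (\<lambda>x::'a::real_normed_vector. norm x > R) at_infinity"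
  unfolding eventually_at_infinity by (meson gt_ex less_le_trans)

lemma norm_bigo_iff:
  "f \<in> norm_bigo s \<longleftrightarrow> (\<exists>C R. \<forall>x. norm x > R \<longrightarrow> \<bar>f x\<bar> \<le> C * norm x powr s)"
proof
  assume "f \<in> norm_bigo s"
  then obtain c where "eventually (\<lambda>x. \<bar>f x\<bar> \<le> c * norm x powr s) at_infinity"
    by (elim landau_o.bigE) auto
  then show "\<exists>C R. \<forall>x. norm x > R \<longrightarrow> \<bar>f x\<bar> \<le> C * norm x powr s"
    unfolding eventually_at_infinity by (meson less_imp_le)
next
  assume "\<exists>C R. \<forall>x. norm x > R \<longrightarrow> \<bar>f x\<bar> \<le> C * norm x powr s"
  then obtain C R where "\<forall>x. norm x > R \<longrightarrow> \<bar>f x\<bar> \<le> C * norm x powr s" by blast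
  then show "f \<in> norm_bigo s"
    by (intro bigoI[of _ C] eventually_mono[OF eventually_norm_gt_at_infinity[of R]]) auto
qed

lemma norm_bigo_cong:
  assumes "eventually (\<lambda>x. f x = g x) at_infinity" "f \<in> norm_bigo s"
  shows "g \<in> norm_bigo s"
  using landau_o.big.in_cong[OF assms(1), of "\<lambda>x. norm x powr s"] assms(2) by simp

lemma norm_bigo_mult:
  assumes "f \<in> norm_bigo a" "g \<in> norm_bigo b" "c = a + b"
  shows "(\<lambda>x. f x * g x) \<in> norm_bigo c"
  using landau_o.big.mult[OF assms(1,2)] by (simp add: powr_add assms(3))

lemma norm_bigo_mono:
  assumes "f \<in> norm_bigo a" "a \<le> b"
  shows "f \<in> norm_bigo b"
  using assms(1)
proof (rule landau_o.big_trans)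
  show "(\<lambda>x::real^3. norm x powr a) \<in> norm_bigo b"
    by (intro bigoI[of _ 1] eventually_mono[OF eventually_norm_gt_at_infinity[of 1]])
      (use assms(2) in \<open>auto intro: powr_mono\<close>)
qed

lemma norm_bigo_const: "(\<lambda>x. a) \<in> norm_bigo 0"
  unfolding norm_bigo_iff
  by (rule exI[of _ "\<bar>a\<bar>"], rule exI[of _ 0]) auto

lemma norm_bigo_component: "(\<lambda>x. x $ i) \<in> norm_bigo 1"
  unfolding norm_bigo_iff
  by (rule exI[of _ 1], rule exI[of _ 0]) (auto simp: component_le_norm_cart)

lemma bigO_deriv_differentiable:
  assumes "bigO_deriv k s f" "length is < k"
  shows "eventually (\<lambda>x. partials is f differentiable (at x)) at_infinity"
proof -
  from assms(1) obtain C R where "\<forall>x. norm x > R \<longrightarrow>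
      (\<forall>is. length is < k \<longrightarrow> partials is f differentiable (at x))"
    unfolding bigO_deriv_def by blast
  with assms(2) show ?thesis
    by (intro eventually_mono[OF eventually_norm_gt_at_infinity[of R]]) auto
qed

lemma bigO_deriv_partials:
  assumes "bigO_deriv k s f" "length is \<le> k"
  shows "partials is f \<in> norm_bigo (- s - real (length is))"
  using assms unfolding norm_bigo_iff bigO_deriv_def by blast

lemma bigO_deriv_bigo: "bigO_deriv k s f \<Longrightarrow> f \<in> norm_bigo (- s)"
  using bigO_deriv_partials[of k s f "[]"] by simp

lemma bigO_deriv_partial: "bigO_deriv k s f \<Longrightarrow> k \<ge> 1 \<Longrightarrow> partial i f \<in> norm_bigo (- s - 1)"
  using bigO_deriv_partials[of k s f "[i]"] by simp

lemma bigO_deriv_differentiable0: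
  "bigO_deriv k s f \<Longrightarrow> k \<ge> 1 \<Longrightarrow> eventually (\<lambda>x. f differentiable (at x)) at_infinity"
  using bigO_deriv_differentiable[of k s f "[]"] by simp

text \<open>\<open>f0\<close> is a leading part of order r^a, correct up to a relative error r^(-q).
  Recording the size of \<open>f0\<close> together with the error is what makes the relation stable
  under products.\<close>

definition approx :: "real \<Rightarrow> real \<Rightarrow> (real^3 \<Rightarrow> real) \<Rightarrow> (real^3 \<Rightarrow> real) \<Rightarrow> bool" where
  "approx q a f f0 \<longleftrightarrow> f0 \<in> norm_bigo a \<and> (\<lambda>x. f x - f0 x) \<in> norm_bigo (a - q)"

lemma approx_refl: "f \<in> norm_bigo a \<Longrightarrow> approx q a f f"
  by (simp add: approx_def)

lemma approx_bigo:
  assumes "approx q a f f0" "q \<ge> 0"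
  shows "f \<in> norm_bigo a"
proof -
  have "(\<lambda>x. f x - f0 x) \<in> norm_bigo a"
    using assms by (auto simp: approx_def intro: norm_bigo_mono)
  then have "(\<lambda>x. (f x - f0 x) + f0 x) \<in> norm_bigo a"
    using assms by (intro sum_in_bigo(1)) (auto simp: approx_def)
  then show ?thesis by simp
qed

lemma approx_add:
  assumes "approx q a f f0" "approx q a g g0"
  shows "approx q a (\<lambda>x. f x + g x) (\<lambda>x. f0 x + g0 x)"
proof -
  have "(\<lambda>x. (f x - f0 x) + (g x - g0 x)) \<in> norm_bigo (a - q)"
    using assms by (intro sum_in_bigo(1)) (auto simp: approx_def)
  then show ?thesis
    using assms by (auto simp: approx_def algebra_simps intro: sum_in_bigo)
qed

lemma approx_diff:
  assumes "approx q a f f0" "approx q a g g0"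
  shows "approx q a (\<lambda>x. f x - g x) (\<lambda>x. f0 x - g0 x)"
proof -
  have "(\<lambda>x. (f x - f0 x) - (g x - g0 x)) \<in> norm_bigo (a - q)"
    using assms by (auto simp: approx_def intro: sum_in_bigo(2))
  then show ?thesis
    using assms by (auto simp: approx_def algebra_simps intro: sum_in_bigo)
qed

lemma approx_sum:
  assumes "\<And>i. i \<in> I \<Longrightarrow> approx q a (f i) (f0 i)"
  shows "approx q a (\<lambda>x. \<Sum>i\<in>I. f i x) (\<lambda>x. \<Sum>i\<in>I. f0 i x)"
  using assms unfolding approx_def
  by (auto simp: sum_subtractf[symmetric] intro!: big_sum_in_bigo)

text \<open>From f g - f0 g0 = (f - f0) g + f0 (g - g0): orders add while the gain q is
  kept.\<close>

lemma approx_mult: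
  assumes f: "approx q a f f0" and g: "approx q b g g0" and q: "q \<ge> 0" and c: "c = a + b"
  shows "approx q c (\<lambda>x. f x * g x) (\<lambda>x. f0 x * g0 x)"
proof -
  have "(\<lambda>x. (f x - f0 x) * g x) \<in> norm_bigo (c - q)"
    using f approx_bigo[OF g q] c by (intro norm_bigo_mult[of _ "a - q" _ b]) (auto simp: approx_def)
  moreover have "(\<lambda>x. f0 x * (g x - g0 x)) \<in> norm_bigo (c - q)"
    using f g c by (intro norm_bigo_mult[of _ a _ "b - q"]) (auto simp: approx_def)
  ultimately have "(\<lambda>x. (f x - f0 x) * g x + f0 x * (g x - g0 x)) \<in> norm_bigo (c - q)"
    by (rule sum_in_bigo)
  moreover have "(\<lambda>x. f0 x * g0 x) \<in> norm_bigo c"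
    using f g c by (intro norm_bigo_mult[of _ a _ b]) (auto simp: approx_def)
  ultimately show ?thesis by (simp add: approx_def algebra_simps)
qed

lemma approx_cong:
  assumes "approx q a f f0" "eventually (\<lambda>x. f x = g x) at_infinity"
    "eventually (\<lambda>x. f0 x = g0 x) at_infinity"
  shows "approx q a g g0"
proof -
  have "eventually (\<lambda>x. f x - f0 x = g x - g0 x) at_infinity"
    using assms(2,3) by eventually_elim simp
  note landau_o.big.in_cong[OF this, of "\<lambda>x. norm x powr (a - q)"]
    landau_o.big.in_cong[OF assms(3), of "\<lambda>x. norm x powr a"]
  with assms(1) show ?thesis by (simp add: approx_def)
qed

text \<open>Exact scaling serves three purposes: decay of the leading terms and their derivatives,
  the 1/\<rho> law for the leading surface integral, and the rigidity that refutes the parity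
  condition. The origin is excluded since the leading terms are singular there.\<close>

definition homogeneous :: "real \<Rightarrow> (real^3 \<Rightarrow> real) \<Rightarrow> bool" where
  "homogeneous d f \<longleftrightarrow> (\<forall>t>0. \<forall>x. x \<noteq> 0 \<longrightarrow> f (t *\<^sub>R x) = t powr d * f x)"

text \<open>The constant is a bound on the unit sphere, which exists by compactness; scaling carries
  it along each ray.\<close>

lemma homogeneous_bigo:
  assumes "homogeneous d f" "continuous_on (- {0}) f"
  shows "f \<in> norm_bigo d"
proof -
  have "continuous_on (sphere 0 1) f"
    by (rule continuous_on_subset[OF assms(2)]) auto
  then have "bounded (f ` sphere 0 1)"
    by (intro compact_imp_bounded compact_continuous_image compact_sphere)
  then obtain C where "\<And>y. y \<in> f ` sphere 0 1 \<Longrightarrow> norm y \<le> C"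
    unfolding bounded_iff by blast
  then have C: "\<bar>f x\<bar> \<le> C" if "norm x = 1" for x
    using that by simp
  have "\<bar>f x\<bar> \<le> C * norm x powr d" if "norm x > 0" for x
  proof -
    have "f (norm x *\<^sub>R sgn x) = norm x powr d * f (sgn x)"
      using assms(1) that by (auto simp: homogeneous_def sgn_zero_iff)
    then have "f x = norm x powr d * f (sgn x)"
      using that by (simp add: sgn_div_norm)
    moreover have "\<bar>f (sgn x)\<bar> \<le> C"
      using that by (intro C) (simp add: norm_sgn)
    ultimately show ?thesis
      by (simp add: abs_mult mult.commute[of C] mult_left_mono)
  qed
  then show ?thesis unfolding norm_bigo_iff by blast
qed

lemma homogeneous_partial:
  assumes "homogeneous d f" "C1_on (- {0}) f"
  shows "homogeneous (d - 1) (partial i f)"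
  unfolding homogeneous_def
proof (intro allI impI)
  fix t :: real and x :: "real^3" assume t: "t > 0" and x: "x \<noteq> 0"
  have d: "f differentiable (at (t *\<^sub>R x))" "f differentiable (at x)"
    using t x by (auto intro: C1_on_differentiable[OF assms(2)])
  have "t * partial i f (t *\<^sub>R x) = partial i (\<lambda>x. f (t *\<^sub>R x)) x"
    by (simp add: partial_scaleR_arg(2)[OF d(1)])
  also have "\<dots> = partial i (\<lambda>x. t powr d * f x) x"
    by (rule partial_cong[of "- {0}"]) (use x t assms(1) in \<open>auto simp: homogeneous_def\<close>)
  also have "\<dots> = t powr d * partial i f x"
    using d by (simp add: partial_mult partial_const)
  finally show "partial i f (t *\<^sub>R x) = t powr (d - 1) * partial i f x"
    using t by (simp add: powr_diff field_simps)
qed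

definition has_parity :: "real \<Rightarrow> (real^3 \<Rightarrow> real) \<Rightarrow> bool" where
  "has_parity \<epsilon> f \<longleftrightarrow> (\<forall>x. x \<noteq> 0 \<longrightarrow> f (- x) = \<epsilon> * f x)"

lemma has_parity_mult:
  "has_parity \<epsilon> f \<Longrightarrow> has_parity \<delta> g \<Longrightarrow> \<eta> = \<epsilon> * \<delta> \<Longrightarrow> has_parity \<eta> (\<lambda>x. f x * g x)"
  by (auto simp: has_parity_def)

lemma has_parity_sum:
  "(\<And>i. i \<in> I \<Longrightarrow> has_parity \<epsilon> (f i)) \<Longrightarrow> has_parity \<epsilon> (\<lambda>x. \<Sum>i\<in>I. f i x)"
  by (auto simp: has_parity_def sum_distrib_left)

lemma has_parity_add:
  "has_parity \<epsilon> f \<Longrightarrow> has_parity \<epsilon> g \<Longrightarrow> has_parity \<epsilon> (\<lambda>x. f x + g x)"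
  by (auto simp: has_parity_def distrib_left)

lemma has_parity_diff:
  "has_parity \<epsilon> f \<Longrightarrow> has_parity \<epsilon> g \<Longrightarrow> has_parity \<epsilon> (\<lambda>x. f x - g x)"
  by (auto simp: has_parity_def right_diff_distrib)

lemma has_parity_partial:
  assumes "has_parity \<epsilon> f" "C1_on (- {0}) f"
  shows "has_parity (- \<epsilon>) (partial i f)"
  unfolding has_parity_def
proof (intro allI impI)
  fix x :: "real^3" assume x: "x \<noteq> 0"
  have d: "f differentiable (at ((-1) *\<^sub>R x))" "f differentiable (at x)"
    using x by (auto intro: C1_on_differentiable[OF assms(2)])
  have "- partial i f (- x) = partial i (\<lambda>x. f (- x)) x"
    using partial_scaleR_arg(2)[OF d(1), of i] by simp
  also have "\<dots> = partial i (\<lambda>x. \<epsilon> * f x) x"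
    by (rule partial_cong[of "- {0}"]) (use x assms(1) in \<open>auto simp: has_parity_def\<close>)
  also have "\<dots> = \<epsilon> * partial i f x"
    using d by (simp add: partial_mult partial_const)
  finally show "partial i f (- x) = - \<epsilon> * partial i f x" by simp
qed

section \<open>Inverses of matrices with variable entries\<close>

lemma matrix_inv_inverse:
  assumes "invertible A"
  shows "A ** matrix_inv A = mat 1" "matrix_inv A ** A = mat 1"
  using someI_ex[OF assms[unfolded invertible_def]] by (simp_all add: matrix_inv_def)

text \<open>Column l of the inverse solves A v = e_l, so Cramer's rule applies. The entries become
  rational functions of those of A and inherit their regularity.\<close>

lemma matrix_inv_cramer:
  fixes A :: "real^'n^'n"
  assumes "det A \<noteq> 0"
  shows "matrix_inv A $ k $ l =
    det (\<chi> i j. if j = k then (if i = l then 1 else 0) else A $ i $ j) / det A"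
proof -
  have axis_nth: "axis l 1 $ i = (if i = l then 1 else (0::real))" for i
    by (simp add: axis_def)
  have "A ** matrix_inv A = mat 1"
    using assms by (simp add: invertible_det_nz matrix_inv_inverse)
  then have "A *v (matrix_inv A *v axis l 1) = axis l 1"
    by (simp add: matrix_vector_mul_assoc)
  then have "matrix_inv A *v axis l 1 =
      (\<chi> k. det (\<chi> i j. if j = k then axis l 1 $ i else A $ i $ j) / det A)"
    using cramer[OF assms] by blast
  then have "(matrix_inv A *v axis l 1) $ k =
      det (\<chi> i j. if j = k then axis l 1 $ i else A $ i $ j) / det A"
    by simp
  then show ?thesis
    unfolding matrix_vector_mult_basis axis_nth by (simp add: column_def)
qed

lemma C1_on_det3:
  fixes M :: "real^3 \<Rightarrow> real^3^3"
  assumes "\<And>i j. C1_on S (\<lambda>x. M x $ i $ j)"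
  shows "C1_on S (\<lambda>x. det (M x))"
  unfolding det_3 by (intro C1_on_intros assms)

lemma C1_on_matrix_inv:
  fixes M :: "real^3 \<Rightarrow> real^3^3"
  assumes M: "\<And>i j. C1_on S (\<lambda>x. M x $ i $ j)" and "open S" and det: "\<And>x. x \<in> S \<Longrightarrow> det (M x) \<noteq> 0"
  shows "C1_on S (\<lambda>x. matrix_inv (M x) $ k $ l)"
proof -
  have "C1_on S (\<lambda>x. (\<chi> i j. if j = k then (if i = l then 1 else 0) else M x $ i $ j) $ i $ j)" for i j
    using M by (cases "j = k"; cases "i = l") auto
  then have "C1_on S (\<lambda>x. det (\<chi> i j. if j = k then (if i = l then 1 else 0) else M x $ i $ j) / det (M x))"
    by (intro C1_on_divide C1_on_det3 M det) auto
  then show ?thesis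
    by (rule C1_on_cong[OF \<open>open S\<close>, THEN iffD1, rotated]) (simp add: matrix_inv_cramer det)
qed

lemma det_nonzero_of_positive_definite:
  fixes A :: "real^'n^'n"
  assumes "\<And>v. v \<noteq> 0 \<Longrightarrow> v \<bullet> (A *v v) > 0"
  shows "det A \<noteq> 0"
proof -
  have "v = 0" if "A *v v = 0" for v using assms[of v] that by force
  then have "invertible A"
    by (metis invertible_left_inverse matrix_left_invertible_ker)
  then show ?thesis by (simp add: invertible_det_nz)
qed

subsection \<open>The divergence constraint\<close>

text \<open>With N the inverse of G, N = I - N (G - I). When G is close to I, the sum of the
  absolute entries of N is therefore bounded by a constant plus a fraction of itself, and that
  fraction can be absorbed.\<close>

lemma matrix_inv_bigo:
  fixes G :: "real^3 \<Rightarrow> real^3^3"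
  assumes inv: "eventually (\<lambda>x. invertible (G x)) at_infinity"
    and s: "s > 0" and G: "\<And>i j. (\<lambda>x. G x $ i $ j - (if i = j then 1 else 0)) \<in> norm_bigo (- s)"
  shows "(\<lambda>x. matrix_inv (G x) $ k $ l) \<in> norm_bigo 0"
proof -
  let ?N = "\<lambda>x. matrix_inv (G x)"
  let ?D = "\<lambda>x i j. G x $ i $ j - (if i = j then 1 else 0)"
  \<comment> \<open>Each entry of N enters three entries of N (G - I), so the threshold 1/6 makes
    the fraction 3/6 = 1/2; then S is at most 3 + S/2, hence at most 6.\<close>
  have "eventually (\<lambda>x. \<bar>?D x i j\<bar> \<le> 1 / 6) at_infinity" for i j
  proof -
    have "(\<lambda>x::real^3. norm x powr (- s)) \<in> o[at_infinity](\<lambda>x. 1)"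
      by (intro smalloI_tendsto)
        (auto intro!: tendsto_neg_powr s filterlim_norm_at_top)
    from landau_o.big_small_trans[OF G[of i j] this]
    have "eventually (\<lambda>x. norm (?D x i j) \<le> 1 / 6 * norm (1::real)) at_infinity"
      by (rule landau_o.smallD) simp
    then show ?thesis by simp
  qed
  then have "eventually (\<lambda>x. \<forall>i j. \<bar>?D x i j\<bar> \<le> 1 / 6) at_infinity"
    by (intro eventually_all_finite)
  with inv have "eventually (\<lambda>x. norm (?N x $ k $ l) \<le> 6 * norm (norm x powr 0)) at_infinity"
    using eventually_norm_gt_at_infinity[of 0]
  proof eventually_elim
    case (elim x)
    define S where "S = (\<Sum>i\<in>UNIV. \<Sum>j\<in>UNIV. \<bar>?N x $ i $ j\<bar>)"
    have N: "?N x $ i $ j = (if i = j then 1 else 0) - (\<Sum>m\<in>UNIV. ?N x $ i $ m * ?D x m j)" for i j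
    proof -
      have "(\<Sum>m\<in>UNIV. ?N x $ i $ m * G x $ m $ j) = (if i = j then 1 else 0)"
        using arg_cong[OF matrix_inv_inverse(2)[OF elim(1)], of "\<lambda>M. M $ i $ j"]
        by (simp add: matrix_matrix_mult_def mat_def)
      then show ?thesis
        by (simp add: right_diff_distrib sum_subtractf if_distrib[of "\<lambda>a. _ * a"] cong: if_cong)
    qed
    have "\<bar>?N x $ i $ j\<bar> \<le> (if i = j then 1 else 0) + (\<Sum>m\<in>UNIV. \<bar>?N x $ i $ m\<bar>) / 6" for i j
    proof -
      have "\<bar>\<Sum>m\<in>UNIV. ?N x $ i $ m * ?D x m j\<bar> \<le> (\<Sum>m\<in>UNIV. \<bar>?N x $ i $ m\<bar> * (1 / 6))"
        using elim(2) unfolding abs_mult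
        by (intro order_trans[OF sum_abs] sum_mono, unfold abs_mult) (intro mult_left_mono; simp)
      also have "\<dots> = (\<Sum>m\<in>UNIV. \<bar>?N x $ i $ m\<bar>) / 6"
        by (simp add: sum_divide_distrib)
      finally show ?thesis by (subst N) (cases "i = j"; simp)
    qed
    then have "S \<le> (\<Sum>i\<in>UNIV. \<Sum>j\<in>UNIV. (if i = j then 1 else 0) + (\<Sum>m\<in>UNIV. \<bar>?N x $ i $ m\<bar>) / 6)"
      unfolding S_def by (intro sum_mono)
    also have "\<dots> = 3 + S / 2"
      unfolding S_def by (simp add: sum_3 add_divide_distrib)
    finally have "S \<le> 6" by simp
    moreover have "\<bar>?N x $ k $ l\<bar> \<le> S"
    proof -
      have "\<bar>?N x $ k $ l\<bar> \<le> (\<Sum>j\<in>UNIV. \<bar>?N x $ k $ j\<bar>)"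
        by (rule member_le_sum) auto
      also have "\<dots> \<le> S"
        unfolding S_def by (rule member_le_sum[of k _ "\<lambda>i. \<Sum>j\<in>UNIV. \<bar>?N x $ i $ j\<bar>"]) (auto intro: sum_nonneg)
      finally show ?thesis .
    qed
    ultimately show ?case using elim(3) by simp
  qed
  then show ?thesis by (rule bigoI)
qed

definition linear_christoffel :: "(3 \<Rightarrow> 3 \<Rightarrow> real^3 \<Rightarrow> real) \<Rightarrow> 3 \<Rightarrow> 3 \<Rightarrow> 3 \<Rightarrow> real^3 \<Rightarrow> real" where
  "linear_christoffel h m k j x = 1/2 * (partial k (h j m) x + partial j (h k m) x - partial m (h k j) x)"

text \<open>Bilinear in h and Q: what the constraint forces the Euclidean divergence to be at first
  order in h. The inverse metric is \<delta> - h to that order, so its correction and both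
  Christoffel terms acquire a plus sign when moved to the other side.\<close>

definition linear_div ::
    "(3 \<Rightarrow> 3 \<Rightarrow> real^3 \<Rightarrow> real) \<Rightarrow> (3 \<Rightarrow> 3 \<Rightarrow> real^3 \<Rightarrow> real) \<Rightarrow> 3 \<Rightarrow> real^3 \<Rightarrow> real" where
  "linear_div h Q j x =
     (\<Sum>k\<in>UNIV. \<Sum>l\<in>UNIV. h k l x * partial k (Q l j) x)
     + (\<Sum>k\<in>UNIV. \<Sum>m\<in>UNIV. linear_christoffel h m k k x * Q m j x)
     + (\<Sum>k\<in>UNIV. \<Sum>m\<in>UNIV. linear_christoffel h m k j x * Q k m x)"

text \<open>The decay hypothesis gives differentiability of the difference only; that of f follows
  from f = (f - g) + g, and only then may \<open>partial\<close> be split.\<close>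

lemma partial_diff_bigo:
  assumes "bigO_deriv k s (\<lambda>x. f x - g x)" "k \<ge> 1" "C1_on (- {0}) g"
  shows "eventually (\<lambda>x. f differentiable (at x)) at_infinity"
    and "(\<lambda>x. partial m f x - partial m g x) \<in> norm_bigo (- s - 1)"
proof -
  have ev: "eventually (\<lambda>x. f differentiable (at x) \<and>
      partial m (\<lambda>x. f x - g x) x = partial m f x - partial m g x) at_infinity"
    using bigO_deriv_differentiable0[OF assms(1,2)] eventually_norm_gt_at_infinity[of 0]
  proof eventually_elim
    case (elim x)
    have g: "g differentiable (at x)"
      using elim by (intro C1_on_differentiable[OF assms(3)]) auto
    have "f differentiable (at x)"
      using differentiable_add[OF elim(1) g] by simp
    with g show ?case by (simp add: partial_diff)
  qed
  then show "eventually (\<lambda>x. f differentiable (at x)) at_infinity"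
    by (rule eventually_mono) simp
  have "eventually (\<lambda>x. partial m (\<lambda>x. f x - g x) x = partial m f x - partial m g x) at_infinity"
    using ev by (rule eventually_mono) simp
  from norm_bigo_cong[OF this bigO_deriv_partial[OF assms(1,2)]]
  show "(\<lambda>x. partial m f x - partial m g x) \<in> norm_bigo (- s - 1)" .
qed

text \<open>Expanding \<open>g\<^sup>-\<^sup>1 = \<delta> - h + \<dots>\<close> and \<open>\<Gamma> = \<Gamma>(h) + \<dots>\<close> in \<open>div\<^sub>g P = 0\<close> gives the Euclidean
  divergence of \<open>P\<close> up to an integrable error.\<close>

lemma euclidean_divergence_expansion:
  fixes G P :: "real^3 \<Rightarrow> real^3^3" and h Q :: "3 \<Rightarrow> 3 \<Rightarrow> real^3 \<Rightarrow> real"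
  assumes q: "0 < q" "q \<le> 1"
    and h: "\<And>i j. C1_on (- {0}) (h i j)" "\<And>i j. homogeneous (- 1) (h i j)"
    and Q: "\<And>i j. C1_on (- {0}) (Q i j)" "\<And>i j. homogeneous (- 2) (Q i j)"
    and G: "\<And>i j. bigO_deriv 2 (1 + q) (\<lambda>x. G x $ i $ j - ((if i = j then 1 else 0) + h i j x))"
    and P: "\<And>i j. bigO_deriv 1 (2 + q) (\<lambda>x. P x $ i $ j - Q i j x)"
    and inv: "eventually (\<lambda>x. invertible (G x)) at_infinity"
    and div: "eventually (\<lambda>x. metric_div G P j x = 0) at_infinity"
  shows "approx q (- 4) (\<lambda>x. \<Sum>k\<in>UNIV. partial k (\<lambda>y. P y $ k $ j) x) (linear_div h Q j)"
proof -
  let ?\<delta> = "\<lambda>i j :: 3. if i = j then 1 else 0 :: real"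
  let ?N = "\<lambda>k l x. matrix_inv (G x) $ k $ l"
  have q0: "q \<ge> 0" using q by simp
  note mult = approx_mult[OF _ _ q0]
  have hO: "h i j \<in> norm_bigo (- 1)" and dhO: "partial m (h i j) \<in> norm_bigo (- 2)" for i j m
    using homogeneous_bigo[OF h(2) C1_on_continuous[OF h(1)]]
      homogeneous_bigo[OF homogeneous_partial[OF h(2,1)] C1_on_continuous_partial[OF h(1)]] by simp_all
  have QO: "Q i j \<in> norm_bigo (- 2)" and dQO: "partial m (Q i j) \<in> norm_bigo (- 3)" for i j m
    using homogeneous_bigo[OF Q(2) C1_on_continuous[OF Q(1)]]
      homogeneous_bigo[OF homogeneous_partial[OF Q(2,1)] C1_on_continuous_partial[OF Q(1)]] by simp_all
  have PQ: "approx q (- 2) (\<lambda>x. P x $ i $ k) (Q i k)" for i k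
    using bigO_deriv_bigo[OF P] QO by (simp add: approx_def)
  have dP: "approx q (- 3) (partial m (\<lambda>x. P x $ i $ k)) (partial m (Q i k))" for m i k
    using partial_diff_bigo(2)[OF P _ Q(1)] dQO by (simp add: approx_def)
  have Gh: "approx q (- 1) (\<lambda>x. G x $ i $ k - ?\<delta> i k) (h i k)" for i k
    using bigO_deriv_bigo[OF G] hO by (simp add: approx_def algebra_simps)
  have dG: "approx q (- 2) (partial m (\<lambda>x. G x $ i $ k)) (partial m (h i k))" for m i k
  proof -
    have "C1_on (- {0}) (\<lambda>x. ?\<delta> i k + h i k x)"
      by (intro C1_on_add C1_on_const h)
    from partial_diff_bigo(2)[OF G _ this, of m]
    have "(\<lambda>x. partial m (\<lambda>x. G x $ i $ k) x - partial m (\<lambda>x. ?\<delta> i k + h i k x) x)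
        \<in> norm_bigo (- 2 - q)"
      by simp
    moreover have "eventually (\<lambda>x. partial m (\<lambda>x. G x $ i $ k) x - partial m (\<lambda>x. ?\<delta> i k + h i k x) x
        = partial m (\<lambda>x. G x $ i $ k) x - partial m (h i k) x) at_infinity"
      using eventually_norm_gt_at_infinity[of 0]
    proof eventually_elim
      case (elim x)
      have "h i k differentiable (at x)"
        using elim by (intro C1_on_differentiable[OF h(1)]) auto
      then show ?case by (simp add: partial_add partial_const)
    qed
    ultimately have "(\<lambda>x. partial m (\<lambda>x. G x $ i $ k) x - partial m (h i k) x) \<in> norm_bigo (- 2 - q)"
      by (rule norm_bigo_cong[rotated])
    with dhO show ?thesis by (simp add: approx_def)
  qed
  have "(\<lambda>x. G x $ i $ k - ?\<delta> i k) \<in> norm_bigo (- 1)" for i k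
    using Gh q0 by (rule approx_bigo)
  from matrix_inv_bigo[OF inv zero_less_one this]
  have NO: "?N k l \<in> norm_bigo 0" for k l .
  have NI: "eventually (\<lambda>x. - (\<Sum>m\<in>UNIV. ?N k m x * (G x $ m $ l - ?\<delta> m l)) = ?N k l x - ?\<delta> k l) at_infinity" for k l
    using inv
  proof eventually_elim
    case (elim x)
    have "(\<Sum>m\<in>UNIV. ?N k m x * G x $ m $ l) = ?\<delta> k l"
      using arg_cong[OF matrix_inv_inverse(2)[OF elim], of "\<lambda>M. M $ k $ l"]
      by (simp add: matrix_matrix_mult_def mat_def)
    then show ?case
      by (simp add: right_diff_distrib sum_subtractf if_distrib[of "\<lambda>a. _ * a"] cong: if_cong)
  qed
  \<comment> \<open>A crude first pass: N - \<delta> = -N (G - \<delta>) is O(r^(-1)), which is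
    weakened to O(r^(-q)) using q \<le> 1.\<close>
  have N\<delta>: "approx q 0 (?N k l) (\<lambda>x. ?\<delta> k l)" for k l
  proof -
    have "(\<lambda>x. \<Sum>m\<in>UNIV. ?N k m x * (G x $ m $ l - ?\<delta> m l)) \<in> norm_bigo (- 1)"
      by (intro big_sum_in_bigo norm_bigo_mult[OF NO approx_bigo[OF Gh q0]]) simp
    then have "(\<lambda>x. - (\<Sum>m\<in>UNIV. ?N k m x * (G x $ m $ l - ?\<delta> m l))) \<in> norm_bigo (- 1)"
      by (simp only: landau_o.big.uminus_in_iff)
    then have "(\<lambda>x. ?N k l x - ?\<delta> k l) \<in> norm_bigo (- 1)"
      by (rule norm_bigo_cong[OF NI])
    then have "(\<lambda>x. ?N k l x - ?\<delta> k l) \<in> norm_bigo (0 - q)"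
      by (rule norm_bigo_mono) (use q in simp)
    with norm_bigo_const show ?thesis unfolding approx_def by blast
  qed
  \<comment> \<open>The second pass reinserts N = \<delta> + O(r^(-q)) into the same identity and so
    identifies the first-order term as -h.\<close>
  have Nh: "approx q (- 1) (\<lambda>x. ?N k l x - ?\<delta> k l) (\<lambda>x. - h k l x)" for k l
  proof -
    have "approx q (- 1) (\<lambda>x. 0 - (\<Sum>m\<in>UNIV. ?N k m x * (G x $ m $ l - ?\<delta> m l)))
        (\<lambda>x. 0 - (\<Sum>m\<in>UNIV. ?\<delta> k m * h m l x))"
      by (intro approx_diff approx_sum mult[OF N\<delta> Gh] approx_refl) simp_all
    then show ?thesis
      by (rule approx_cong) (use NI in \<open>simp_all add: if_distrib[of "\<lambda>a. a * _"] cong: if_cong\<close>)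
  qed
  have \<Gamma>: "approx q (- 2) (christoffel G m k l) (linear_christoffel h m k l)" for m k l
  proof -
    have "approx q (- 2) (\<lambda>x. 1/2 * (\<Sum>l'\<in>UNIV. ?N m l' x *
       (partial k (\<lambda>y. G y $ l $ l') x + partial l (\<lambda>y. G y $ k $ l') x
        - partial l' (\<lambda>y. G y $ k $ l) x)))
      (\<lambda>x. 1/2 * (\<Sum>l'\<in>UNIV. ?\<delta> m l' *
       (partial k (h l l') x + partial l (h k l') x - partial l' (h k l) x)))"
      by (intro mult[OF approx_refl[OF norm_bigo_const]] approx_sum mult[OF N\<delta>]
          approx_add approx_diff dG) (simp_all add: dG)
    then show ?thesis
      unfolding christoffel_def[abs_def] linear_christoffel_def[abs_def]
      by (simp add: if_distrib[of "\<lambda>a. a * _"] cong: if_cong)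
  qed
  \<comment> \<open>The orders are -2 - 2 for Christoffel symbol times P and -1 - 3 for metric
    perturbation times derivative of P; both give -4, with relative gain q.\<close>
  have "approx q (- 4)
    (\<lambda>x. (\<Sum>k\<in>UNIV. \<Sum>l\<in>UNIV. ?N k l x *
            ((\<Sum>m\<in>UNIV. christoffel G m k l x * P x $ m $ j)
            + (\<Sum>m\<in>UNIV. christoffel G m k j x * P x $ l $ m)))
         - (\<Sum>k\<in>UNIV. \<Sum>l\<in>UNIV. (?N k l x - ?\<delta> k l) * partial k (\<lambda>y. P y $ l $ j) x))
    (\<lambda>x. (\<Sum>k\<in>UNIV. \<Sum>l\<in>UNIV. ?\<delta> k l *
            ((\<Sum>m\<in>UNIV. linear_christoffel h m k l x * Q m j x)
            + (\<Sum>m\<in>UNIV. linear_christoffel h m k j x * Q l m x)))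
         - (\<Sum>k\<in>UNIV. \<Sum>l\<in>UNIV. (- h k l x) * partial k (Q l j) x))"
    by (intro approx_diff approx_sum mult[OF N\<delta>] approx_add mult[OF \<Gamma> PQ] mult[OF Nh dP]) simp_all
  then show ?thesis
  proof (rule approx_cong)
    show "eventually (\<lambda>x. (\<Sum>k\<in>UNIV. \<Sum>l\<in>UNIV. ?N k l x *
            ((\<Sum>m\<in>UNIV. christoffel G m k l x * P x $ m $ j)
            + (\<Sum>m\<in>UNIV. christoffel G m k j x * P x $ l $ m)))
         - (\<Sum>k\<in>UNIV. \<Sum>l\<in>UNIV. (?N k l x - ?\<delta> k l) * partial k (\<lambda>y. P y $ l $ j) x)
         = (\<Sum>k\<in>UNIV. partial k (\<lambda>y. P y $ k $ j) x)) at_infinity"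
      using div
    proof eventually_elim
      case (elim x)
      let ?A = "\<lambda>k l. (\<Sum>m\<in>UNIV. christoffel G m k l x * P x $ m $ j)"
      let ?B = "\<lambda>k l. (\<Sum>m\<in>UNIV. christoffel G m k j x * P x $ l $ m)"
      let ?d = "\<lambda>k l. partial k (\<lambda>y. P y $ l $ j) x"
      have "(\<Sum>k\<in>UNIV. \<Sum>l\<in>UNIV. ?N k l x * (?A k l + ?B k l))
          - (\<Sum>k\<in>UNIV. \<Sum>l\<in>UNIV. (?N k l x - ?\<delta> k l) * ?d k l)
          = (\<Sum>k\<in>UNIV. \<Sum>l\<in>UNIV. ?\<delta> k l * ?d k l)
            - (\<Sum>k\<in>UNIV. \<Sum>l\<in>UNIV. ?N k l x * (?d k l - ?A k l - ?B k l))"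
        by (simp only: distrib_left right_diff_distrib left_diff_distrib sum_subtractf sum.distrib)
      also have "\<dots> = (\<Sum>k\<in>UNIV. ?d k k)"
        using elim by (simp add: metric_div_def if_distrib[of "\<lambda>a. a * _"] cong: if_cong)
      finally show ?case .
    qed
    show "eventually (\<lambda>x. (\<Sum>k\<in>UNIV. \<Sum>l\<in>UNIV. ?\<delta> k l *
            ((\<Sum>m\<in>UNIV. linear_christoffel h m k l x * Q m j x)
            + (\<Sum>m\<in>UNIV. linear_christoffel h m k j x * Q l m x)))
         - (\<Sum>k\<in>UNIV. \<Sum>l\<in>UNIV. (- h k l x) * partial k (Q l j) x)
         = linear_div h Q j x) at_infinity"
      by (intro always_eventually allI)
        (simp add: linear_div_def sum.distrib sum_negf if_distrib[of "\<lambda>a. a * _"] cong: if_cong)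
  qed
qed

subsection \<open>The leading terms\<close>

lemma rotation_field_nth:
  "rotation_field x $ 1 = x $ 3" "rotation_field x $ 2 = 0" "rotation_field x $ 3 = - x $ 1"
  by (simp_all add: rotation_field_def axis_def)

text \<open>The powers of \<open>1 / norm x\<close>, including the first, are left uncombined so that
  \<open>partial_inverse_power_norm\<close> below applies to them.\<close>

definition metric_conformal :: "real \<Rightarrow> real^3 \<Rightarrow> real" where
  "metric_conformal A x = A * (1 / norm x ^ 1) - 1/2 * (x $ 1 * x $ 1 * (1 / norm x ^ 3))"

definition metric_radial :: "real^3 \<Rightarrow> real" where
  "metric_radial x = x $ 1 * x $ 1 * (1 / norm x ^ 5)"

text \<open>The perturbation h, split into an isotropic part with coefficient A/r - \<alpha>/(2r)
  and a radial part with coefficient \<alpha>/r^3.\<close>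

definition metric_leading :: "real \<Rightarrow> 3 \<Rightarrow> 3 \<Rightarrow> real^3 \<Rightarrow> real" where
  "metric_leading A i j x =
     (if i = j then 1 else 0) * metric_conformal A x + metric_radial x * (x $ i * x $ j)"

definition momentum_radial :: "real^3 \<Rightarrow> real" where
  "momentum_radial x = x $ 1 * x $ 3 * (1 / norm x ^ 6)"

definition momentum_leading :: "3 \<Rightarrow> 3 \<Rightarrow> real^3 \<Rightarrow> real" where
  "momentum_leading i j x = momentum_radial x * (x $ i * x $ j)"

definition momentum_odd :: "real^3 \<Rightarrow> 3 \<Rightarrow> 3 \<Rightarrow> real^3 \<Rightarrow> real" where
  "momentum_odd B i j x = 1 / norm x ^ 3 *
     (- (B $ i) * x $ j - B $ j * x $ i + (\<Sum>l\<in>UNIV. B $ l * x $ l) * (if i = j then 1 else 0))"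

text \<open>Both identities hold at \<open>x = 0\<close> as well, where every quotient is \<open>0\<close>.\<close>

lemma metric_leading_eq:
  "(1 + A / norm x) * (if i = j then 1 else 0) +
     alpha x / norm x * (x $ i * x $ j / (norm x)\<^sup>2 - 1/2 * (if i = j then 1 else 0))
     = (if i = j then 1 else 0) + metric_leading A i j x"
  by (cases "x = 0") (simp_all add: metric_leading_def metric_conformal_def metric_radial_def
      alpha_def field_simps eval_nat_numeral)

lemma momentum_leading_eq:
  "beta x / (norm x)\<^sup>2 * (x $ i * x $ j / (norm x)\<^sup>2) = momentum_leading i j x"
  by (cases "x = 0")
    (simp_all add: momentum_leading_def momentum_radial_def beta_def field_simps eval_nat_numeral)

lemma C1_on_leading [simp]:
  "C1_on (- {0}) (metric_conformal A)" "C1_on (- {0}) metric_radial"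
  "C1_on (- {0}) (metric_leading A i j)" "C1_on (- {0}) momentum_radial"
  "C1_on (- {0}) (momentum_leading i j)" "C1_on (- {0}) (momentum_odd B i j)"
  unfolding metric_leading_def[abs_def] metric_conformal_def[abs_def] metric_radial_def[abs_def]
    momentum_leading_def[abs_def] momentum_radial_def[abs_def] momentum_odd_def[abs_def]
  by (intro C1_on_intros; simp)+

lemma homogeneous_leading:
  "homogeneous (- 1) (metric_leading A i j)"
  "homogeneous (- 2) (momentum_leading i j)"
  "homogeneous (- 2) (momentum_odd B i j)"
proof -
  have p: "t powr (- 2) = 1 / t ^ 2" if "t > 0" for t :: real
    using that by (simp add: powr_minus_divide)
  show "homogeneous (- 1) (metric_leading A i j)"
    by (auto simp: homogeneous_def metric_leading_def metric_conformal_def metric_radial_def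
        powr_minus_divide field_simps eval_nat_numeral)
  show "homogeneous (- 2) (momentum_leading i j)"
    unfolding homogeneous_def
    by (auto simp: p momentum_leading_def momentum_radial_def field_simps eval_nat_numeral)
  show "homogeneous (- 2) (momentum_odd B i j)"
    unfolding homogeneous_def
    by (auto simp: p momentum_odd_def sum_3 field_simps eval_nat_numeral)
qed

lemma has_parity_leading:
  "has_parity 1 (metric_leading A i j)" "has_parity (- 1) (momentum_odd B i j)"
  by (auto simp: has_parity_def metric_leading_def metric_conformal_def metric_radial_def
      momentum_odd_def sum_3 algebra_simps)

lemma partial_inverse_power_norm:
  assumes "x \<noteq> 0" "n > 0"
  shows "(\<lambda>x. 1 / norm x ^ n) differentiable (at x)"
    and "partial i (\<lambda>x. 1 / norm x ^ n) x = - real n * x $ i / norm x ^ (n + 2)"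
proof -
  have "((\<lambda>t. 1 / t ^ n) has_derivative (*) (- real n / norm x ^ (n + 1))) (at (norm x))"
    unfolding has_field_derivative_def[symmetric]
    by (rule derivative_eq_intros refl)+
      (use assms in \<open>simp_all add: divide_simps power_add[symmetric] flip: power_Suc power_Suc2\<close>)
  from has_derivative_compose[OF has_derivative_norm[OF assms(1)] this]
  have D: "((\<lambda>x. 1 / norm x ^ n) has_derivative
      (\<lambda>v. (- real n / norm x ^ (n + 1)) * (v \<bullet> sgn x))) (at x)" .
  then show "(\<lambda>x. 1 / norm x ^ n) differentiable (at x)"
    unfolding differentiable_def by blast
  from partial_eqI[OF D, of i] assms
  show "partial i (\<lambda>x. 1 / norm x ^ n) x = - real n * x $ i / norm x ^ (n + 2)"
    by (simp add: inner_axis' sgn_div_norm power_add field_simps)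
qed

text \<open>The derivatives of the two coefficients stay symbolic: after contraction with the
  rotation field only their rotational combination remains, and it is computed separately.\<close>

lemma partial_metric_leading:
  assumes "x \<noteq> 0"
  shows "partial k (metric_leading A i j) x =
    (if i = j then 1 else 0) * partial k (metric_conformal A) x
    + (partial k metric_radial x * (x $ i * x $ j)
       + metric_radial x * ((if k = i then x $ j else 0) + (if k = j then x $ i else 0)))"
proof -
  have d: "metric_conformal A differentiable (at x)" "metric_radial differentiable (at x)"
    using assms by (auto intro!: C1_on_differentiable[of "- {0}"])
  have c: "(\<lambda>x. x $ i) differentiable (at x)" for i :: 3 and x :: "real^3"
    by (rule C1_on_differentiable[OF C1_on_component UNIV_I])
  show ?thesis
    unfolding metric_leading_def[abs_def]
    by (simp add: partial_add partial_mult partial_const partial_component d c algebra_simps)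
qed

lemma partial_momentum_leading:
  assumes "x \<noteq> 0"
  shows "partial k (momentum_leading i j) x = partial k momentum_radial x * (x $ i * x $ j)
       + momentum_radial x * ((if k = i then x $ j else 0) + (if k = j then x $ i else 0))"
proof -
  have d: "momentum_radial differentiable (at x)"
    using assms by (auto intro!: C1_on_differentiable[of "- {0}"])
  have c: "(\<lambda>x. x $ i) differentiable (at x)" for i :: 3 and x :: "real^3"
    by (rule C1_on_differentiable[OF C1_on_component UNIV_I])
  show ?thesis
    unfolding momentum_leading_def[abs_def]
    by (simp add: partial_mult partial_component d c algebra_simps)
qed

text \<open>Rotations annihilate functions of the norm. Thus A and the powers of r drop out, and
  only the rotational derivative 2 x_1 x_3 of x_1^2 is left; this is the relation Y \<alpha> =
  2\<beta>.\<close>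

lemma rotation_derivative_metric:
  assumes "x \<noteq> 0"
  shows "x $ 3 * partial 1 (metric_conformal A) x - x $ 1 * partial 3 (metric_conformal A) x
      = - (x $ 1 * x $ 3 / norm x ^ 3)"
    and "x $ 3 * partial 1 metric_radial x - x $ 1 * partial 3 metric_radial x
      = 2 * (x $ 1 * x $ 3) / norm x ^ 5"
proof -
  have c: "(\<lambda>x. x $ i) differentiable (at x)" for i :: 3 and x :: "real^3"
    by (rule C1_on_differentiable[OF C1_on_component UNIV_I])
  note n = partial_inverse_power_norm[OF assms]
  show "x $ 3 * partial 1 (metric_conformal A) x - x $ 1 * partial 3 (metric_conformal A) x
      = - (x $ 1 * x $ 3 / norm x ^ 3)"
  proof -
    have n1: "(\<lambda>x. 1 / norm x ^ 1) differentiable (at x)" and n3: "(\<lambda>x. 1 / norm x ^ 3) differentiable (at x)"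
      by (rule n(1); simp)+
    have "partial i (metric_conformal A) x = A * partial i (\<lambda>x. 1 / norm x ^ 1) x
        - 1/2 * (x $ 1 * x $ 1 * partial i (\<lambda>x. 1 / norm x ^ 3) x
          + (x $ 1 * (if i = 1 then 1 else 0) + (if i = 1 then 1 else 0) * x $ 1) * (1 / norm x ^ 3))" for i
      unfolding metric_conformal_def[abs_def]
      by (simp only: partial_diff partial_mult partial_const partial_component n1 n3 c
          differentiable_mult differentiable_const mult_zero_left add_0_right)
    then show ?thesis
      by (simp only: n(2)[of 1] n(2)[of 3] zero_less_one zero_less_numeral) (simp add: algebra_simps)
  qed
  show "x $ 3 * partial 1 metric_radial x - x $ 1 * partial 3 metric_radial x
      = 2 * (x $ 1 * x $ 3) / norm x ^ 5"
  proof -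
    have n5: "(\<lambda>x. 1 / norm x ^ 5) differentiable (at x)"
      by (rule n(1); simp)
    have "partial i metric_radial x = x $ 1 * x $ 1 * partial i (\<lambda>x. 1 / norm x ^ 5) x
          + (x $ 1 * (if i = 1 then 1 else 0) + (if i = 1 then 1 else 0) * x $ 1) * (1 / norm x ^ 5)" for i
      unfolding metric_radial_def[abs_def]
      by (simp only: partial_mult partial_component n5 c differentiable_mult)
    then show ?thesis
      by (simp only: n(2)[of 5] zero_less_numeral) (simp add: algebra_simps)
  qed
qed

lemma norm_sq_real3: "norm (x :: real^3) ^ 2 = (x $ 1)\<^sup>2 + (x $ 2)\<^sup>2 + (x $ 3)\<^sup>2"
  unfolding power2_norm_eq_inner inner_vec_def by (simp add: sum_3 power2_eq_square)

text \<open>Only the rotational derivatives of the coefficients of \<open>h\<close> survive, since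
  \<open>x\<close> and the rotation field are orthogonal.\<close>

lemma rotation_linear_div_leading:
  assumes "x \<noteq> 0"
  shows "(\<Sum>j\<in>UNIV. rotation_field x $ j * linear_div (metric_leading A) momentum_leading j x)
    = (x $ 1)\<^sup>2 * (x $ 3)\<^sup>2 / (2 * norm x ^ 7)"
proof -
  let ?r2 = "(x $ 1)\<^sup>2 + (x $ 2)\<^sup>2 + (x $ 3)\<^sup>2"
  \<comment> \<open>Against the symmetric radial momentum only the summand of the Christoffel symbol
    differentiated along the rotation survives, whence the factor 1/2. The factors r^2 and r^4 arise
    from contracting \<delta>_km and x_k x_m with x_k x_m; the bracket then equals (-1 + 2) x_1 x_3
    / r.\<close>
  have "(\<Sum>j\<in>UNIV. rotation_field x $ j * linear_div (metric_leading A) momentum_leading j x)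
    = 1/2 * momentum_radial x *
      ((x $ 3 * partial 1 (metric_conformal A) x - x $ 1 * partial 3 (metric_conformal A) x) * ?r2
      + (x $ 3 * partial 1 metric_radial x - x $ 1 * partial 3 metric_radial x) * ?r2\<^sup>2)"
    by (simp add: sum_3 rotation_field_nth linear_div_def linear_christoffel_def
        partial_metric_leading[OF assms] partial_momentum_leading[OF assms])
      (simp add: metric_leading_def momentum_leading_def power2_eq_square field_simps)
  also have "\<dots> = (x $ 1)\<^sup>2 * (x $ 3)\<^sup>2 / (2 * norm x ^ 7)"
    unfolding rotation_derivative_metric[OF assms] norm_sq_real3[symmetric] momentum_radial_def
    using assms by (simp add: field_simps eval_nat_numeral)
  finally show ?thesis .
qed

subsection \<open>Growth of the flux\<close>

lemma linear_div_add:
  assumes "\<And>i j. Q i j differentiable (at x)" "\<And>i j. Q' i j differentiable (at x)"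
  shows "linear_div h (\<lambda>i j x. Q i j x + Q' i j x) j x = linear_div h Q j x + linear_div h Q' j x"
  by (simp add: linear_div_def partial_add[OF assms] distrib_left sum.distrib)

text \<open>Every term is a product of one h and one Q with exactly one derivative, and each
  derivative flips the sign: even times odd becomes even.\<close>

lemma has_parity_linear_div:
  assumes "\<And>i j. has_parity 1 (h i j)" "\<And>i j. C1_on (- {0}) (h i j)"
    and "\<And>i j. has_parity (- 1) (Q i j)" "\<And>i j. C1_on (- {0}) (Q i j)"
  shows "has_parity 1 (linear_div h Q j)"
proof -
  have dh: "has_parity (- 1) (partial m (h i j))" and dQ: "has_parity 1 (partial m (Q i j))" for m i j
    using has_parity_partial[OF assms(1,2)] has_parity_partial[OF assms(3,4)] by simp_all
  have "has_parity (- 1) (linear_christoffel h m k l)" for m k l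
    unfolding linear_christoffel_def[abs_def]
    by (rule has_parity_mult[of 1 _ "-1"])
      (auto intro!: has_parity_add has_parity_diff dh simp: has_parity_def[of 1 "\<lambda>_. _"])
  then show ?thesis
    unfolding linear_div_def[abs_def]
    by (intro has_parity_add has_parity_sum has_parity_mult[OF assms(1) dQ]
        has_parity_mult[OF _ assms(3)]) simp_all
qed

lemma continuous_on_linear_div:
  assumes "\<And>i j. C1_on S (h i j)" "\<And>i j. C1_on S (Q i j)"
  shows "continuous_on S (linear_div h Q j)"
proof -
  note c = assms[THEN C1_on_continuous] assms[THEN C1_on_continuous_partial]
  show ?thesis
    unfolding linear_div_def[abs_def] linear_christoffel_def by (intro continuous_intros c)
qed

text \<open>Area scales like \<rho>^2 and the integrand like \<rho>^(-3); the resulting 1/\<rho> is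
  the source of the logarithm.\<close>

lemma sphere_integral_homogeneous:
  assumes "homogeneous (- 3) f" "\<rho> > 0"
  shows "sphere_integral f \<rho> = sphere_integral f 1 / \<rho>"
proof -
  have "\<rho>\<^sup>2 * sin (fst z) * f (polar_point \<rho> z) = (1 / \<rho>) * (1\<^sup>2 * sin (fst z) * f (polar_point 1 z))" for z
  proof -
    have "norm (polar_point 1 z) = 1" by (simp add: norm_polar_point)
    then have "polar_point 1 z \<noteq> 0" by force
    then have "f (polar_point \<rho> z) = 1 / \<rho> ^ 3 * f (polar_point 1 z)"
      using assms by (subst polar_point_scaleR) (simp add: homogeneous_def powr_minus_divide)
    then show ?thesis using assms(2) by (simp add: field_simps eval_nat_numeral)
  qed
  then show ?thesis by (simp add: sphere_integral_def)
qed

text \<open>The value is not computed. A continuous nonnegative integrand with zero integral would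
  vanish identically, but at \<theta> = pi/4, \<phi> = 0 both x_1 and x_3 are nonzero.\<close>

lemma sphere_integral_leading_pos:
  "sphere_integral (\<lambda>x. (x $ 1)\<^sup>2 * (x $ 3)\<^sup>2 / (2 * norm x ^ 7)) 1 > 0"
proof -
  let ?f = "\<lambda>z. 1\<^sup>2 * sin (fst z) * ((polar_point 1 z $ 1)\<^sup>2 * (polar_point 1 z $ 3)\<^sup>2 / (2 * norm (polar_point 1 z) ^ 7))"
  have cont: "continuous_on polar_box ?f"
    by (auto simp: norm_polar_point intro!: continuous_intros continuous_on_polar_point_nth)
  have nonneg: "0 \<le> ?f z" if "z \<in> polar_box" for z
    using that by (auto simp: cbox_Pair_eq mem_Times_iff intro!: divide_nonneg_nonneg mult_nonneg_nonneg sin_ge_zero)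
  have "integral polar_box ?f \<noteq> 0"
  proof
    assume "integral polar_box ?f = 0"
    then have "(?f has_integral 0) polar_box"
      using integrable_integral[OF integrable_continuous[OF cont]] by simp
    moreover have "(1, 1) \<in> box (0, 0) (pi, 2 * pi)"
      using pi_gt3 by (auto simp: mem_box Basis_prod_def)
    then have "box (0, 0) (pi, 2 * pi) \<noteq> {}" by blast
    moreover have "(pi / 4, 0) \<in> polar_box"
      by (auto simp: cbox_Pair_eq mem_Times_iff)
    ultimately have "?f (pi / 4, 0) = 0"
      using nonneg box_subset_cbox by (intro has_integral_0_cbox_imp_0[OF cont]) blast+
    then show False
      by (simp add: polar_point_nth norm_polar_point sin_45 cos_45)
  qed
  moreover have "integral polar_box ?f \<ge> 0"
    using nonneg by (intro integral_nonneg integrable_continuous cont)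
  ultimately show ?thesis by (simp add: sphere_integral_def)
qed

lemma sphere_integral_bigo:
  assumes f: "f \<in> norm_bigo s" and cont: "continuous_on (- cball 0 R) f"
  shows "\<exists>C R'. \<forall>\<rho>>R'. \<bar>sphere_integral f \<rho>\<bar> \<le> C * \<rho> powr (2 + s)"
proof -
  from f obtain C R' where C: "\<And>x. norm x > R' \<Longrightarrow> \<bar>f x\<bar> \<le> C * norm x powr s"
    unfolding norm_bigo_iff by blast
  have "\<bar>sphere_integral f \<rho>\<bar> \<le> (2 * pi\<^sup>2 * C) * \<rho> powr (2 + s)" if "\<rho> > max 0 (max R R')" for \<rho>
  proof -
    have "\<bar>sphere_integral f \<rho>\<bar> \<le> 2 * pi\<^sup>2 * \<rho>\<^sup>2 * (C * \<rho> powr s)"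
      using that by (intro sphere_integral_abs_le continuous_on_subset[OF cont]) (auto dest!: C)
    also have "\<rho>\<^sup>2 = \<rho> powr 2" using that by simp
    finally show ?thesis by (simp add: powr_add mult_ac)
  qed
  then show ?thesis by blast
qed

text \<open>F - c ln is nondecreasing on a half-line, so F eventually dominates c ln plus a
  constant.\<close>

lemma filterlim_at_top_of_derivative:
  fixes F F' :: "real \<Rightarrow> real"
  assumes "c > 0" and F: "\<And>t. t > R \<Longrightarrow> (F has_real_derivative F' t) (at t)"
    and F': "\<And>t. t > R \<Longrightarrow> F' t \<ge> c / t"
  shows "filterlim F at_top at_top"
proof -
  define a where "a = max 1 (R + 1)"
  have "F a - c * ln a + c * ln t \<le> F t" if "t \<ge> a" for t
  proof -
    have "F a - c * ln a \<le> F t - c * ln t"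
    proof (rule DERIV_nonneg_imp_nondecreasing[OF that])
      fix x assume "a \<le> x"
      then have x: "x > R" "x > 0" by (auto simp: a_def)
      have "((\<lambda>t. F t - c * ln t) has_real_derivative F' x - c / x) (at x)"
        by (rule derivative_eq_intros F x refl)+ simp
      moreover have "F' x - c / x \<ge> 0" using F'[OF x(1)] by simp
      ultimately show "\<exists>y. ((\<lambda>t. F t - c * ln t) has_real_derivative y) (at x) \<and> 0 \<le> y" by blast
    qed
    then show ?thesis by simp
  qed
  then have "eventually (\<lambda>t. F a - c * ln a + c * ln t \<le> F t) at_top"
    by (auto simp: eventually_at_top_linorder)
  moreover have "filterlim (\<lambda>t. F a - c * ln a + c * ln t) at_top at_top"
    by (intro filterlim_tendsto_add_at_top[OF tendsto_const]
        filterlim_tendsto_pos_mult_at_top[OF tendsto_const \<open>c > 0\<close>] ln_at_top)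
  ultimately show ?thesis by (rule filterlim_at_top_mono[rotated])
qed

text \<open>The manifold has disappeared: constraint, expansions and flux all live in the single
  chart at infinity, so plain matrix-valued functions on the complement of a ball suffice.\<close>

lemma angular_flux_at_top:
  fixes G P :: "real^3 \<Rightarrow> real^3^3"
  assumes q: "0 < q" "q \<le> 1" and R: "R \<ge> 0"
    and C1: "\<And>i j. C1_on (- cball 0 R) (\<lambda>x. P x $ i $ j)"
    and sym: "\<And>x i j. x \<in> - cball 0 R \<Longrightarrow> P x $ i $ j = P x $ j $ i"
    and inv: "eventually (\<lambda>x. invertible (G x)) at_infinity"
    and div: "\<And>j. eventually (\<lambda>x. metric_div G P j x = 0) at_infinity"
    and G: "\<And>i j. bigO_deriv 2 (1 + q)
       (\<lambda>x. G x $ i $ j - ((if i = j then 1 else 0) + metric_leading A i j x))"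
    and P: "\<And>i j. bigO_deriv 1 (2 + q)
       (\<lambda>x. P x $ i $ j - (momentum_leading i j x + momentum_odd B i j x))"
  shows "filterlim (angular_flux P rotation_field) at_top at_top"
proof -
  let ?h = "metric_leading A"
  let ?S = "- cball (0 :: real^3) R"
  define V where "V k x = (\<Sum>j\<in>UNIV. P x $ j $ k * rotation_field x $ j)" for k x
  define D where "D x = (\<Sum>k\<in>UNIV. partial k (V k) x)" for x
  define lead where "lead x = (x $ 1)\<^sup>2 * (x $ 3)\<^sup>2 / (2 * norm x ^ 7)" for x :: "real^3"
  define odd where "odd x = (\<Sum>j\<in>UNIV. rotation_field x $ j * linear_div ?h (momentum_odd B) j x)" for x
  have S0: "?S \<subseteq> - {0}" "open ?S" using R by auto
  have Y: "C1_on T (\<lambda>x. rotation_field x $ j)" for T j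
    using exhaust_3[of j] C1_on_diff[OF C1_on_const C1_on_component, of T 0 1]
    by (elim disjE) (simp_all add: rotation_field_nth)
  have YO: "(\<lambda>x. rotation_field x $ j) \<in> norm_bigo 1" for j
    using exhaust_3[of j] norm_bigo_component
    by (elim disjE) (simp_all add: rotation_field_nth)
  have VC1: "C1_on ?S (V k)" for k
    unfolding V_def[abs_def] by (intro C1_on_sum C1_on_mult C1 Y)
  have Dc: "continuous_on ?S D"
    unfolding D_def[abs_def] by (intro continuous_intros C1_on_continuous_partial VC1)
  have leadc: "continuous_on (- {0}) lead"
    unfolding lead_def[abs_def] by (intro continuous_intros) auto
  have oddc: "continuous_on (- {0}) odd"
    unfolding odd_def[abs_def]
    by (intro continuous_intros C1_on_continuous[OF Y] continuous_on_linear_div) simp_all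
  \<comment> \<open>The Jacobian of a Euclidean Killing field is antisymmetric; contracted with the
    symmetric P it vanishes, which leaves only derivatives of P.\<close>
  have D_eq: "D x = (\<Sum>j\<in>UNIV. rotation_field x $ j * (\<Sum>k\<in>UNIV. partial k (\<lambda>y. P y $ k $ j) x))"
    if x: "x \<in> ?S" for x
  proof -
    have dY: "partial k (\<lambda>x. rotation_field x $ j) x
        = (if j = 1 \<and> k = 3 then 1 else 0) - (if j = 3 \<and> k = 1 then 1 else 0)" for j k
      using exhaust_3[of j] partial_diff[of "\<lambda>_. 0" x "\<lambda>x. x $ 1" k] C1_on_differentiable[OF C1_on_component UNIV_I]
      by (elim disjE) (auto simp: rotation_field_nth partial_const partial_component)
    have "partial k (V k) x = (\<Sum>j\<in>UNIV. P x $ j $ k * partial k (\<lambda>x. rotation_field x $ j) x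
        + partial k (\<lambda>y. P y $ k $ j) x * rotation_field x $ j)" for k
    proof -
      have d: "(\<lambda>x. P x $ j $ k) differentiable (at x)" "(\<lambda>x. rotation_field x $ j) differentiable (at x)" for j
        using C1_on_differentiable[OF C1 x] C1_on_differentiable[OF Y UNIV_I] by auto
      have "partial k (\<lambda>y. P y $ j $ k) x = partial k (\<lambda>y. P y $ k $ j) x" for j
        using S0(2) x by (rule partial_cong) (rule sym)
      then show ?thesis
        unfolding V_def[abs_def] by (simp add: partial_sum partial_mult d differentiable_mult)
    qed
    then have "D x = (\<Sum>k\<in>UNIV. \<Sum>j\<in>UNIV. P x $ j $ k * partial k (\<lambda>x. rotation_field x $ j) x)
        + (\<Sum>k\<in>UNIV. \<Sum>j\<in>UNIV. partial k (\<lambda>y. P y $ k $ j) x * rotation_field x $ j)"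
      by (simp add: D_def sum.distrib)
    also have "(\<Sum>k\<in>UNIV. \<Sum>j\<in>UNIV. P x $ j $ k * partial k (\<lambda>x. rotation_field x $ j) x) = 0"
      using sym[OF x, of 1 3] by (simp add: dY sum_3)
    also have "(\<Sum>k\<in>UNIV. \<Sum>j\<in>UNIV. partial k (\<lambda>y. P y $ k $ j) x * rotation_field x $ j)
        = (\<Sum>j\<in>UNIV. rotation_field x $ j * (\<Sum>k\<in>UNIV. partial k (\<lambda>y. P y $ k $ j) x))"
      by (subst sum.swap) (simp add: sum_distrib_left mult.commute)
    finally show ?thesis by simp
  qed
  define err where "err x = D x - (lead x + odd x)" for x
  have errc: "continuous_on ?S err"
    unfolding err_def[abs_def]
    by (intro continuous_intros Dc continuous_on_subset[OF leadc] continuous_on_subset[OF oddc] S0)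
  have err: "err \<in> norm_bigo (- 3 - q)"
  proof -
    have exp: "approx q (- 4) (\<lambda>x. \<Sum>k\<in>UNIV. partial k (\<lambda>y. P y $ k $ j) x)
        (linear_div ?h (\<lambda>i j x. momentum_leading i j x + momentum_odd B i j x) j)" for j
      by (rule euclidean_divergence_expansion[OF q _ _ _ _ G P inv div])
        (simp_all add: homogeneous_leading C1_on_add,
          use homogeneous_leading in \<open>simp add: homogeneous_def distrib_left\<close>)
    have "approx q (- 3)
      (\<lambda>x. \<Sum>j\<in>UNIV. rotation_field x $ j * (\<Sum>k\<in>UNIV. partial k (\<lambda>y. P y $ k $ j) x))
      (\<lambda>x. \<Sum>j\<in>UNIV. rotation_field x $ j *
        linear_div ?h (\<lambda>i j x. momentum_leading i j x + momentum_odd B i j x) j x)"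
      using q by (intro approx_sum approx_mult[OF approx_refl[OF YO] exp]) simp_all
    then have "(\<lambda>x. (\<Sum>j\<in>UNIV. rotation_field x $ j * (\<Sum>k\<in>UNIV. partial k (\<lambda>y. P y $ k $ j) x))
      - (\<Sum>j\<in>UNIV. rotation_field x $ j *
        linear_div ?h (\<lambda>i j x. momentum_leading i j x + momentum_odd B i j x) j x)) \<in> norm_bigo (- 3 - q)"
      unfolding approx_def by blast
    moreover have "eventually (\<lambda>x. (\<Sum>j\<in>UNIV. rotation_field x $ j * (\<Sum>k\<in>UNIV. partial k (\<lambda>y. P y $ k $ j) x))
      - (\<Sum>j\<in>UNIV. rotation_field x $ j *
        linear_div ?h (\<lambda>i j x. momentum_leading i j x + momentum_odd B i j x) j x) = err x) at_infinity"
      using eventually_norm_gt_at_infinity[of R]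
    proof eventually_elim
      case (elim x)
      then have x: "x \<in> ?S" "x \<in> - {0}" "x \<noteq> 0" using R by auto
      have d: "momentum_leading i j differentiable (at x)" "momentum_odd B i j differentiable (at x)" for i j
        using x(2) by (auto intro: C1_on_differentiable[OF C1_on_leading(5)] C1_on_differentiable[OF C1_on_leading(6)])
      show ?case
        unfolding err_def D_eq[OF x(1)] linear_div_add[OF d] lead_def odd_def
          rotation_linear_div_leading[OF x(3), symmetric, of A]
        by (simp add: distrib_left sum.distrib)
    qed
    ultimately show ?thesis by (rule norm_bigo_cong[rotated])
  qed
  have odd_parity: "has_parity (- 1) odd"
  proof -
    have "has_parity (- 1) (\<lambda>x. rotation_field x $ j)" for j
      using exhaust_3[of j] by (elim disjE) (simp_all add: has_parity_def rotation_field_nth)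
    then show ?thesis
      unfolding odd_def[abs_def]
      by (intro has_parity_sum has_parity_mult[OF _ has_parity_linear_div])
        (simp_all add: has_parity_leading)
  qed
  have sph: "sphere 0 \<rho> \<subseteq> ?S" if "\<rho> > R" for \<rho> using that by auto
  have sph0: "sphere 0 \<rho> \<subseteq> - {0 :: real^3}" if "\<rho> > R" for \<rho> using that R by auto
  have D_split: "sphere_integral D \<rho> = sphere_integral lead 1 / \<rho> + sphere_integral err \<rho>"
    if "\<rho> > R" for \<rho>
  proof -
    note c = continuous_on_subset[OF leadc sph0[OF that]] continuous_on_subset[OF oddc sph0[OF that]]
      continuous_on_subset[OF errc sph[OF that]]
    have "\<rho> \<ge> 0" using that R by simp
    have "D = (\<lambda>x. (lead x + odd x) + err x)" by (auto simp: err_def)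
    then have "sphere_integral D \<rho> = sphere_integral lead \<rho> + sphere_integral odd \<rho> + sphere_integral err \<rho>"
      using c \<open>\<rho> \<ge> 0\<close> by (simp add: sphere_integral_add continuous_on_add)
    moreover have "sphere_integral odd \<rho> = 0"
      using c(2) \<open>\<rho> \<ge> 0\<close>
    proof (rule sphere_integral_odd)
      fix x :: "real^3" assume "norm x = \<rho>"
      then have "x \<noteq> 0" using that R by auto
      then show "odd (- x) = - odd x" using odd_parity by (simp add: has_parity_def)
    qed
    moreover have "homogeneous (- 3) lead"
      by (auto simp: homogeneous_def lead_def powr_minus_divide field_simps eval_nat_numeral)
    then have "sphere_integral lead \<rho> = sphere_integral lead 1 / \<rho>"
      using that R by (intro sphere_integral_homogeneous) auto
    ultimately show ?thesis by simp
  qed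
  have Vn: "continuous_on ?S (\<lambda>x. V k x * (x $ k / norm x))" for k
    using R by (intro continuous_intros C1_on_continuous[OF VC1]) auto
  define F where "F \<rho> = (\<Sum>k\<in>UNIV. sphere_integral (\<lambda>x. V k x * (x $ k / norm x)) \<rho>)" for \<rho>
  have flux: "angular_flux P rotation_field \<rho> = F \<rho>" if "\<rho> > R" for \<rho>
  proof -
    note c = continuous_on_subset[OF Vn sph[OF that]]
    have "angular_flux P rotation_field \<rho>
        = (LINT x:sphere 0 \<rho>|sphere_measure \<rho>. \<Sum>k\<in>UNIV. V k x * (x $ k / norm x))"
      unfolding angular_flux_def V_def sum_distrib_right by (subst sum.swap) (rule refl)
    also have "\<dots> = sphere_integral (\<lambda>x. \<Sum>k\<in>UNIV. V k x * (x $ k / norm x)) \<rho>"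
      using that R by (intro sphere_integral_eq_lebesgue continuous_on_sum c) auto
    also have "\<dots> = F \<rho>"
      using that R c by (simp add: F_def sum_3 sphere_integral_add continuous_on_add)
    finally show ?thesis .
  qed
  have F': "(F has_real_derivative sphere_integral D \<rho>) (at \<rho>)" if "\<rho> > R" for \<rho>
  proof -
    note c = continuous_on_subset[OF C1_on_continuous_partial[OF VC1] sph[OF that]]
    have "(F has_real_derivative (\<Sum>k\<in>UNIV. sphere_integral (partial k (V k)) \<rho>)) (at \<rho>)"
      unfolding F_def[abs_def]
      by (intro DERIV_sum has_real_derivative_sphere_integral[OF VC1 R that])
    also have "(\<Sum>k\<in>UNIV. sphere_integral (partial k (V k)) \<rho>) = sphere_integral D \<rho>"
      using that R c by (simp add: D_def[abs_def] sum_3 sphere_integral_add continuous_on_add)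
    finally show ?thesis .
  qed
  define c where "c = sphere_integral lead 1"
  have "c > 0"
    unfolding c_def lead_def[abs_def] by (rule sphere_integral_leading_pos)
  obtain C R' where C: "\<And>\<rho>. \<rho> > R' \<Longrightarrow> \<bar>sphere_integral err \<rho>\<bar> \<le> C * \<rho> powr (2 + (- 3 - q))"
    using sphere_integral_bigo[OF err errc] by blast
  have "((\<lambda>\<rho>. C * \<rho> powr (- q)) \<longlongrightarrow> 0) at_top"
    using q by (intro tendsto_mult_right_zero tendsto_neg_powr filterlim_ident) simp
  moreover have "0 < c / 2" using \<open>c > 0\<close> by simp
  ultimately have "eventually (\<lambda>\<rho>. C * \<rho> powr (- q) < c / 2) at_top"
    by (rule order_tendstoD(2))
  then obtain R'' where R'': "\<And>\<rho>. \<rho> \<ge> R'' \<Longrightarrow> C * \<rho> powr (- q) < c / 2"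
    unfolding eventually_at_top_linorder by blast
  define R3 where "R3 = Max {R, R', R''}"
  have "sphere_integral D \<rho> \<ge> (c / 2) / \<rho>" if "\<rho> > R3" for \<rho>
  proof -
    have \<rho>: "\<rho> > R" "\<rho> > R'" "\<rho> \<ge> R''" "\<rho> > 0" using that R by (auto simp: R3_def)
    \<comment> \<open>The error is o(1/\<rho>), so beyond \<open>R3\<close> it uses up at most half
      of the main term c/\<rho>; this is where c/2 comes from.\<close>
    have "C * \<rho> powr (2 + (- 3 - q)) = C * \<rho> powr (- q) / \<rho>"
      using \<rho>(4) by (simp add: powr_diff powr_minus field_simps powr_add)
    also have "\<dots> \<le> (c / 2) / \<rho>"
      using R''[OF \<rho>(3)] \<rho>(4) by (intro divide_right_mono) auto
    finally have "\<bar>sphere_integral err \<rho>\<bar> \<le> (c / 2) / \<rho>" using C[OF \<rho>(2)] by simp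
    moreover have "c / \<rho> = (c / 2) / \<rho> + (c / 2) / \<rho>" by simp
    ultimately show ?thesis unfolding D_split[OF \<rho>(1)] c_def[symmetric] by linarith
  qed
  then have "filterlim F at_top at_top"
    using \<open>c > 0\<close> F' by (intro filterlim_at_top_of_derivative[of "c / 2" R3 F "sphere_integral D"])
      (auto simp: R3_def)
  moreover have "eventually (\<lambda>\<rho>. angular_flux P rotation_field \<rho> = F \<rho>) at_top"
    using eventually_gt_at_top[of R] by eventually_elim (rule flux)
  note filterlim_cong[OF refl refl this, of at_top]
  ultimately show ?thesis by simp
qed

section \<open>Failure of the parity condition, and the theorem\<close>

lemma homogeneous_eq_0_of_bigo:
  assumes "homogeneous d f" "f \<in> norm_bigo s" "s < d" "v \<noteq> 0"
  shows "f v = 0"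
proof -
  from assms(2) obtain C R where C: "\<And>x. norm x > R \<Longrightarrow> \<bar>f x\<bar> \<le> C * norm x powr s"
    unfolding norm_bigo_iff by blast
  have "eventually (\<lambda>t. \<bar>f v\<bar> \<le> C * norm v powr s * t powr (s - d)) at_top"
    using eventually_gt_at_top[of 0] eventually_gt_at_top[of "R / norm v"]
  proof eventually_elim
    case (elim t)
    have "t powr d * \<bar>f v\<bar> = \<bar>f (t *\<^sub>R v)\<bar>"
      using assms(1,4) elim by (simp add: homogeneous_def abs_mult)
    also have "\<dots> \<le> C * norm (t *\<^sub>R v) powr s"
      using assms(4) elim by (intro C) (simp add: field_simps)
    also have "\<dots> = t powr d * (C * norm v powr s * t powr (s - d))"
      using elim by (simp add: powr_mult powr_diff)
    finally show ?case using elim by simp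
  qed
  moreover have "((\<lambda>t. C * norm v powr s * t powr (s - d)) \<longlongrightarrow> 0) at_top"
    using assms(3) by (intro tendsto_mult_right_zero tendsto_neg_powr filterlim_ident) simp
  ultimately have "\<bar>f v\<bar> \<le> 0"
    by (intro tendsto_lowerbound[OF _ _ trivial_limit_at_top_linorder])
  then show ?thesis by simp
qed

lemma norm_bigo_reflect: "f \<in> norm_bigo s \<Longrightarrow> (\<lambda>x. f (- x)) \<in> norm_bigo s"
  unfolding norm_bigo_iff by (metis norm_minus_cancel)

theorem corollary3p4:
  fixes \<A> :: "('m::{t2_space,second_countable_topology}) chart set"
    and g K :: "'m tensor2" and c :: "'m chart"
    and q A :: real and B :: "real^3"
  assumes q: "1/2 < q" "q < 1"
    and data: "vacuum_af_data \<A> g K q c"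
    and metric: "\<And>i j. bigO_deriv 2 (1 + q)
      (\<lambda>x. g c x $ i $ j -
         ((1 + A / norm x) * (if i = j then 1 else 0) +
          alpha x / norm x * (x $ i * x $ j / (norm x)\<^sup>2 - 1/2 * (if i = j then 1 else 0))))"
    and momentum: "\<And>i j. bigO_deriv 1 (2 + q)
      (\<lambda>x. momentum g K c x $ i $ j -
         (beta x / (norm x)\<^sup>2 * (x $ i * x $ j / (norm x)\<^sup>2) +
          1 / norm x ^ 3 *
            (- (B $ i) * x $ j - B $ j * x $ i +
             (\<Sum>l\<in>UNIV. B $ l * x $ l) * (if i = j then 1 else 0))))"
  shows "\<not> regge_teitelboim \<A> g K q c \<and>
    filterlim (angular_flux (momentum g K c) rotation_field) at_infinity at_top"
proof
  let ?G = "g c" and ?P = "momentum g K c"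
  let ?S = "- cball (0 :: real^3) 1"
  have c: "c \<in> \<A>" "chart_image c = ?S"
    and vac: "vacuum_data \<A> g K"
    and gO: "\<And>i j. bigO_deriv 2 q (\<lambda>x. g c x $ i $ j - (if i = j then 1 else 0))"
    and KO: "\<And>i j. bigO_deriv 1 (1 + q) (\<lambda>x. K c x $ i $ j)"
    using data unfolding vacuum_af_data_def by blast+
  have gm: "riemannian_metric \<A> g" and K: "symmetric_tensor2 \<A> K"
    using vac unfolding vacuum_data_def initial_data_set_def by blast+
  have C1: "C1_on ?S (\<lambda>x. T c x $ i $ j)" and sym: "\<And>x. x \<in> ?S \<Longrightarrow> T c x $ i $ j = T c x $ j $ i"
    if "symmetric_tensor2 \<A> T" for T i j
  proof -
    show "C1_on ?S (\<lambda>x. T c x $ i $ j)"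
      using that c unfolding symmetric_tensor2_def smooth_tensor2_def
      by (metis smooth_scalar_on_imp_C1_on)
    fix x assume "x \<in> ?S"
    then have "transpose (T c x) = T c x"
      using that c unfolding symmetric_tensor2_def by blast
    from arg_cong[OF this, of "\<lambda>M. M $ j $ i"] show "T c x $ i $ j = T c x $ j $ i"
      by (simp add: transpose_def)
  qed
  have g: "symmetric_tensor2 \<A> g" using gm unfolding riemannian_metric_def by blast
  have det: "det (?G x) \<noteq> 0" if "x \<in> ?S" for x
    using gm c that unfolding riemannian_metric_def by (intro det_nonzero_of_positive_definite) blast
  have inS: "eventually (\<lambda>x. x \<in> ?S) at_infinity"
    using eventually_norm_gt_at_infinity[of 1] by eventually_elim simp
  have inv: "eventually (\<lambda>x. invertible (?G x)) at_infinity"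
    using inS by eventually_elim (use det invertible_det_nz in blast)
  have P_nth: "?P x $ i $ j = K c x $ i $ j - metric_trace ?G (K c) x * ?G x $ i $ j" for x i j
    by (simp add: momentum_def)
  have C1_trace: "C1_on ?S (metric_trace ?G (K c))"
    unfolding metric_trace_def[abs_def]
    by (intro C1_on_sum C1_on_mult C1_on_matrix_inv C1 g K det) auto
  have leading: "bigO_deriv 1 (2 + q) (\<lambda>x. ?P x $ i $ j - (momentum_leading i j x + momentum_odd B i j x))" for i j
    using momentum[of i j] unfolding momentum_leading_eq momentum_odd_def .
  have "filterlim (angular_flux ?P rotation_field) at_top at_top"
  proof (rule angular_flux_at_top[of q 1])
    show "C1_on ?S (\<lambda>x. ?P x $ i $ j)" for i j
      unfolding P_nth by (intro C1_on_diff C1_on_mult C1_trace C1 g K)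
    show "?P x $ i $ j = ?P x $ j $ i" if "x \<in> ?S" for x i j
      using sym[OF g that, of i j] sym[OF K that, of i j] by (simp add: P_nth)
    show "eventually (\<lambda>x. metric_div ?G ?P j x = 0) at_infinity" for j
      using inS by eventually_elim (use vac c in \<open>unfold vacuum_data_def, blast\<close>)
    show "bigO_deriv 2 (1 + q) (\<lambda>x. ?G x $ i $ j - ((if i = j then 1 else 0) + metric_leading A i j x))" for i j
      using metric[of i j] unfolding metric_leading_eq .
  qed (use q inv leading in auto)
  \<comment> \<open>The flux tends to plus infinity, which is stronger than divergence in absolute
    value.\<close>
  then show "filterlim (angular_flux ?P rotation_field) at_infinity at_top"
    by (rule filterlim_mono[OF _ at_top_le_at_infinity order_refl])
  show "\<not> regge_teitelboim \<A> g K q c"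
  proof
    assume "regge_teitelboim \<A> g K q c"
    then have RT: "(\<lambda>x. K c x $ 1 $ 3 + K c (- x) $ 1 $ 3) \<in> norm_bigo (- 2 - q)"
      unfolding regge_teitelboim_def using bigO_deriv_bigo[of 1 "2 + q"] by fastforce
    let ?e = "\<lambda>x. ?P x $ 1 $ 3 - (momentum_leading 1 3 x + momentum_odd B 1 3 x)"
    let ?t = "\<lambda>x. metric_trace ?G (K c) x * ?G x $ 1 $ 3"
    \<comment> \<open>The exponent -1 - 2q is that of the trace term, (-1 - q) for the trace plus -q
      for the off-diagonal metric component. It lies above -2 - q because q < 1, so all errors fit
      under it, and below -2 because q > 1/2, so it beats the leading momentum.\<close>
    have e: "?e \<in> norm_bigo (- 1 - 2 * q)"
      using norm_bigo_mono[OF bigO_deriv_bigo[OF leading[of 1 3]], of "- 1 - 2 * q"] q by simp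
    have "metric_trace ?G (K c) \<in> norm_bigo (- 1 - q)"
      unfolding metric_trace_def[abs_def]
      using q bigO_deriv_bigo[OF KO] bigO_deriv_bigo[OF gO]
      by (intro big_sum_in_bigo norm_bigo_mult[of _ 0 _ "- 1 - q"] matrix_inv_bigo[OF inv, of q]) simp_all
    then have t: "?t \<in> norm_bigo (- 1 - 2 * q)"
      using bigO_deriv_bigo[OF gO[of 1 3]]
      by (intro norm_bigo_mult[of _ "- 1 - q" _ "- q"]) simp_all
    have "(\<lambda>x. K c x $ 1 $ 3 + K c (- x) $ 1 $ 3) \<in> norm_bigo (- 1 - 2 * q)"
      using RT by (rule norm_bigo_mono) (use q in simp)
    then have "(\<lambda>x. (K c x $ 1 $ 3 + K c (- x) $ 1 $ 3) - (?t x + ?t (- x)) - (?e x + ?e (- x)))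
        \<in> norm_bigo (- 1 - 2 * q)"
      by (intro sum_in_bigo(2) sum_in_bigo(1)[OF t norm_bigo_reflect[OF t]]
          sum_in_bigo(1)[OF e norm_bigo_reflect[OF e]])
    \<comment> \<open>Symmetrizing cancels the odd B-terms and doubles the even leading
      term.\<close>
    moreover have "(K c x $ 1 $ 3 + K c (- x) $ 1 $ 3) - (?t x + ?t (- x)) - (?e x + ?e (- x))
        = 2 * momentum_leading 1 3 x" for x
      by (simp add: P_nth momentum_leading_def momentum_radial_def momentum_odd_def sum_3 algebra_simps)
    ultimately have "momentum_leading 1 3 \<in> norm_bigo (- 1 - 2 * q)"
      by simp
    \<comment> \<open>A function homogeneous of degree -2 cannot decay faster unless it is zero; the
      test vector e_1 + e_3 has x_1 x_3 = 1, so the leading term is nonzero there.\<close>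
    then have "momentum_leading 1 3 (axis 1 1 + axis 3 1) = 0"
      by (rule homogeneous_eq_0_of_bigo[OF homogeneous_leading(2)])
        (use q in \<open>auto simp: vec_eq_iff forall_3 axis_def\<close>)
    moreover have "(axis 1 1 + axis 3 1 :: real^3) \<noteq> 0"
      by (auto simp: vec_eq_iff forall_3 axis_def)
    ultimately show False
      by (simp add: momentum_leading_def momentum_radial_def axis_def)
  qed
qed

end
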